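(* Let $\Gamma$ be a rectifiable Jordan curve, let $w:\Gamma\to[0,\infty]$ be a weight, and let $X$ be a Banach function space over $\Gamma$. If the Cauchy singular integral operator $S$ is bounded on the weighted Banach function space $X_w$, then $w\in A_X(\Gamma)$.
   Context: A rectifiable Jordan curve $\Gamma\subset\mathbb{C}$ (homeomorphic to a circle) carries Lebesgue length measure $|d\tau|$ and the counter-clockwise orientation. For $t\in\Gamma$, $R>0$: $\Gamma(t,R)=\{\tau\in\Gamma:|\tau-t|<R\}$. A weight is a measurable $w:\Gamma\to[0,\infty]$ with $0<w<\infty$ a.e. Let $\mathcal{M}^+$ be the set of measurable functions $\Gamma\to[0,\infty]$. A map $\rho:\mathcal{M}^+\to[0,\infty]$ is a Banach function norm if for all $f,g,f_n\in\mathcal{M}^+$, $a\ge0$ and measurable $E\subset\Gamma$: (A1) $\rho(f)=0\Leftrightarrow f=0$ a.e., $\rho(af)=a\rho(f)$, $\rho(f+g)\le\rho(f)+\rho(g)$; (A2) $0\le g\le f$ a.e. implies $\rho(g)\le\rho(f)$; (A3) $0\le f_n\uparrow f$ a.e. implies $\rho(f_n)\uparrow\rho(f)$; (A4) $\rho(\chi_E)<\infty$; (A5) $\int_E f\,|d\tau|\le C_E\rho(f)$ with $C_E\in(0,\infty)$ independent of $f$. The Banach function space $X$ consists of all measurable complex $f$ (modulo null sets) with $\|f\|_X:=\rho(|f|)<\infty$. Its associate space $X'$ is the Banach function space generated by $\rho'(g)=\sup\{\int_\Gamma fg\,|d\tau|: f\in\mathcal{M}^+,\rho(f)\le1\}$.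 For a weight $w$, $X_w=\{f \text{ measurable}: fw\in X\}$, a normed linear space with $\|f\|_{X_w}=\|fw\|_X$. The Cauchy singular integral is $(Sf)(t)=\lim_{R\to0}\frac{1}{\pi i}\int_{\Gamma\setminus\Gamma(t,R)}\frac{f(\tau)}{\tau-t}\,d\tau$. $A_X(\Gamma)$ is the class of all weights $w$ with $\sup_{t\in\Gamma}\sup_{R>0}\frac1R\|w\chi_{\Gamma(t,R)}\|_X\|\chi_{\Gamma(t,R)}/w\|_{X'}<\infty$. *)

theory Defs
  imports "HOL-Analysis.Analysis" "HOL-Complex_Analysis.Winding_Numbers"
begin

section \<open>Rectifiable Jordan curves\<close>

text \<open>A Jordan curve \<open>\<Gamma>\<close> is handled through a parametrization \<open>g\<close> on \<open>[0,1]\<close>, so that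
  \<open>\<Gamma> = path_image g\<close>. Everything below that depends on \<open>g\<close> is defined by way of the arc-length
  reparametrization, and depends (up to the choice of the starting point) on \<open>\<Gamma>\<close> only.\<close>

text \<open>Supremum of the lengths of the polygons inscribed in \<open>g\<close> restricted to \<open>[a,b]\<close>.\<close>

definition curve_length :: "(real \<Rightarrow> complex) \<Rightarrow> real \<Rightarrow> real \<Rightarrow> ennreal" where
  "curve_length g a b =
     (SUP (n, p) \<in> {(n::nat, p::nat \<Rightarrow> real). mono p \<and> range p \<subseteq> {a..b}}.
        \<Sum>i<n. ennreal (dist (g (p i)) (g (p (Suc i)))))"

definition rectifiable_jordan_curve :: "(real \<Rightarrow> complex) \<Rightarrow> bool" where
  "rectifiable_jordan_curve g \<longleftrightarrow>
     simple_path g \<and> pathfinish g = pathstart g \<and> curve_length g 0 1 < \<infinity>"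

definition counterclockwise :: "(real \<Rightarrow> complex) \<Rightarrow> bool" where
  "counterclockwise g \<longleftrightarrow> (\<forall>z \<in> inside (path_image g). winding_number g z = 1)"

definition arc_length :: "(real \<Rightarrow> complex) \<Rightarrow> real \<Rightarrow> real" where
  "arc_length g x = enn2real (curve_length g 0 x)"

definition total_length :: "(real \<Rightarrow> complex) \<Rightarrow> real" where
  "total_length g = arc_length g 1"

text \<open>For a rectifiable Jordan curve \<open>arc_length g\<close> is a bijection of \<open>{0..1}\<close> onto
  \<open>{0..total_length g}\<close>; values outside the latter interval are irrelevant.\<close>

definition arc_length_param :: "(real \<Rightarrow> complex) \<Rightarrow> real \<Rightarrow> complex" where
  "arc_length_param g s = g (inv_into {0..1} (arc_length g) s)"

text \<open>The Lebesgue length measure \<open>|d\<tau>|\<close>, a complete measure with space \<open>path_image g\<close>.\<close>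

definition length_measure :: "(real \<Rightarrow> complex) \<Rightarrow> complex measure" where
  "length_measure g =
     completion (distr (restrict_space lborel {0..total_length g})
       (restrict_space borel (path_image g)) (arc_length_param g))"

text \<open>\<open>\<Gamma>(t,R)\<close>\<close>

definition portion :: "(real \<Rightarrow> complex) \<Rightarrow> complex \<Rightarrow> real \<Rightarrow> complex set" where
  "portion g t R = {\<tau> \<in> path_image g. cmod (\<tau> - t) < R}"

text \<open>Line integrals \<open>\<integral>\<^sub>E f(\<tau>) d\<tau>\<close> over \<open>E \<subseteq> \<Gamma>\<close>: in terms of the arc-length parametrization
  \<open>\<gamma>\<close>, \<open>d\<tau> = \<gamma>'(s) ds\<close>, where \<open>\<gamma>'\<close> exists almost everywhere.\<close>

definition line_integrand :: "(real \<Rightarrow> complex) \<Rightarrow> (complex \<Rightarrow> complex) \<Rightarrow> real \<Rightarrow> complex" where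
  "line_integrand g f s =
     f (arc_length_param g s) * vector_derivative (arc_length_param g) (at s)"

definition param_set :: "(real \<Rightarrow> complex) \<Rightarrow> complex set \<Rightarrow> real set" where
  "param_set g E = {s \<in> {0..total_length g}. arc_length_param g s \<in> E}"

definition line_integrable :: "(real \<Rightarrow> complex) \<Rightarrow> complex set \<Rightarrow> (complex \<Rightarrow> complex) \<Rightarrow> bool" where
  "line_integrable g E f \<longleftrightarrow> set_integrable lebesgue (param_set g E) (line_integrand g f)"

definition line_integral :: "(real \<Rightarrow> complex) \<Rightarrow> complex set \<Rightarrow> (complex \<Rightarrow> complex) \<Rightarrow> complex" where
  "line_integral g E f = set_lebesgue_integral lebesgue (param_set g E) (line_integrand g f)"


section \<open>Banach function spaces and weights\<close>

text \<open>The norm \<open>\<rho>\<close> is only constrained on measurable functions.\<close>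

definition banach_function_norm :: "'a measure \<Rightarrow> (('a \<Rightarrow> ennreal) \<Rightarrow> ennreal) \<Rightarrow> bool" where
  "banach_function_norm M \<rho> \<longleftrightarrow>
     (\<forall>f \<in> borel_measurable M. \<rho> f = 0 \<longleftrightarrow> (AE x in M. f x = 0)) \<and>
     (\<forall>f \<in> borel_measurable M. \<forall>a::real. 0 \<le> a \<longrightarrow> \<rho> (\<lambda>x. ennreal a * f x) = ennreal a * \<rho> f) \<and>
     (\<forall>f \<in> borel_measurable M. \<forall>g \<in> borel_measurable M. \<rho> (\<lambda>x. f x + g x) \<le> \<rho> f + \<rho> g) \<and>
     (\<forall>f \<in> borel_measurable M. \<forall>g \<in> borel_measurable M.
        (AE x in M. g x \<le> f x) \<longrightarrow> \<rho> g \<le> \<rho> f) \<and>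
     (\<forall>F f. (\<forall>n::nat. F n \<in> borel_measurable M) \<longrightarrow> f \<in> borel_measurable M \<longrightarrow>
        (AE x in M. incseq (\<lambda>n. F n x) \<and> (\<lambda>n. F n x) \<longlonglongrightarrow> f x) \<longrightarrow>
        incseq (\<lambda>n. \<rho> (F n)) \<and> (\<lambda>n. \<rho> (F n)) \<longlonglongrightarrow> \<rho> f) \<and>
     (\<forall>E \<in> sets M. \<rho> (indicator E) < \<infinity>) \<and>
     (\<forall>E \<in> sets M. \<exists>C::real. 0 < C \<and>
        (\<forall>f \<in> borel_measurable M. (\<integral>\<^sup>+x\<in>E. f x \<partial>M) \<le> ennreal C * \<rho> f))"

definition associate_norm :: "'a measure \<Rightarrow> (('a \<Rightarrow> ennreal) \<Rightarrow> ennreal) \<Rightarrow> ('a \<Rightarrow> ennreal) \<Rightarrow> ennreal" where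
  "associate_norm M \<rho> g = (SUP f \<in> {f \<in> borel_measurable M. \<rho> f \<le> 1}. \<integral>\<^sup>+x. f x * g x \<partial>M)"

definition weight :: "'a measure \<Rightarrow> ('a \<Rightarrow> ennreal) \<Rightarrow> bool" where
  "weight M w \<longleftrightarrow> w \<in> borel_measurable M \<and> (AE x in M. 0 < w x \<and> w x < \<infinity>)"

text \<open>Since \<open>w\<close> is extended-real valued, \<open>\<parallel>f w\<parallel>\<^sub>X = \<rho>(|f w|)\<close> is written as \<open>\<rho>(|f| w)\<close>. Functions are
  not identified modulo null sets; \<open>\<rho>\<close> does not see the difference.\<close>

definition weighted_norm :: "(('a \<Rightarrow> ennreal) \<Rightarrow> ennreal) \<Rightarrow> ('a \<Rightarrow> ennreal) \<Rightarrow> ('a \<Rightarrow> complex) \<Rightarrow> ennreal" where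
  "weighted_norm \<rho> w f = \<rho> (\<lambda>x. ennreal (cmod (f x)) * w x)"

definition weighted_space ::
    "'a measure \<Rightarrow> (('a \<Rightarrow> ennreal) \<Rightarrow> ennreal) \<Rightarrow> ('a \<Rightarrow> ennreal) \<Rightarrow> ('a \<Rightarrow> complex) set" where
  "weighted_space M \<rho> w = {f \<in> borel_measurable M. weighted_norm \<rho> w f < \<infinity>}"

text \<open>The class \<open>A\<^sub>X(\<Gamma>)\<close>. The norms may be infinite, so they are expressed by \<open>\<rho>\<close> and its associate
  norm. In \<^typ>\<open>ennreal\<close> one has \<open>0 / 0 = 0\<close>, so \<open>\<chi> / w\<close> vanishes off \<open>\<Gamma>(t,R)\<close>.\<close>

definition A_class ::
    "(real \<Rightarrow> complex) \<Rightarrow> ((complex \<Rightarrow> ennreal) \<Rightarrow> ennreal) \<Rightarrow> (complex \<Rightarrow> ennreal) set" where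
  "A_class g \<rho> = {w. weight (length_measure g) w \<and>
     (SUP t \<in> path_image g. SUP R \<in> {0<..}.
        ennreal (1 / R) * \<rho> (\<lambda>\<tau>. w \<tau> * indicator (portion g t R) \<tau>)
          * associate_norm (length_measure g) \<rho> (\<lambda>\<tau>. indicator (portion g t R) \<tau> / w \<tau>)) < \<infinity>}"


section \<open>The Cauchy singular integral\<close>

definition cauchy_truncated :: "(real \<Rightarrow> complex) \<Rightarrow> (complex \<Rightarrow> complex) \<Rightarrow> complex \<Rightarrow> real \<Rightarrow> complex" where
  "cauchy_truncated g f t R =
     1 / (of_real pi * \<i>) * line_integral g (path_image g - portion g t R) (\<lambda>\<tau>. f \<tau> / (\<tau> - t))"

definition cauchy_singular_integral :: "(real \<Rightarrow> complex) \<Rightarrow> (complex \<Rightarrow> complex) \<Rightarrow> complex \<Rightarrow> complex" where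
  "cauchy_singular_integral g f t = Lim (at_right 0) (cauchy_truncated g f t)"

text \<open>\<open>(S f)(t)\<close> makes sense: the truncated integrals exist as Lebesgue integrals and converge.\<close>

definition cauchy_singular_integral_exists ::
    "(real \<Rightarrow> complex) \<Rightarrow> (complex \<Rightarrow> complex) \<Rightarrow> complex \<Rightarrow> bool" where
  "cauchy_singular_integral_exists g f t \<longleftrightarrow>
     (\<forall>R>0. line_integrable g (path_image g - portion g t R) (\<lambda>\<tau>. f \<tau> / (\<tau> - t))) \<and>
     (\<exists>z. (cauchy_truncated g f t \<longlongrightarrow> z) (at_right 0))"

text \<open>\<open>S\<close> is a bounded operator on all of \<open>X\<^sub>w\<close>; in particular \<open>S f\<close> is defined almost everywhere
  on \<open>\<Gamma>\<close> for every \<open>f\<close> in \<open>X\<^sub>w\<close>.\<close>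

definition cauchy_singular_bounded ::
    "(real \<Rightarrow> complex) \<Rightarrow> ((complex \<Rightarrow> ennreal) \<Rightarrow> ennreal) \<Rightarrow> (complex \<Rightarrow> ennreal) \<Rightarrow> bool" where
  "cauchy_singular_bounded g \<rho> w \<longleftrightarrow>
     (\<exists>C::real. \<forall>f \<in> weighted_space (length_measure g) \<rho> w.
        (AE t in length_measure g. cauchy_singular_integral_exists g f t) \<and>
        cauchy_singular_integral g f \<in> weighted_space (length_measure g) \<rho> w \<and>
        weighted_norm \<rho> w (cauchy_singular_integral g f) \<le> ennreal C * weighted_norm \<rho> w f)"

end

(*
  Let r be small, t a point of the curve and z a point of the curve with |z - t| = 3 r (one exists by
  connectedness). Seen from a point of Gamma(z,r), the whole of Gamma(t,r) lies in a sector of opening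
  less than pi at distance comparable to r. Hence, if the phase of f cancels the tangent direction,
  |S f| is at least a constant times (1/r) int |f| on Gamma(z,r) for every f supported in Gamma(t,r).
  Boundedness of S and duality give
    ||w chi_Gamma(z,r)||_X ||chi_Gamma(t,r)/w||_X' <= K r,
  and the same with z and t exchanged. Multiplying the two estimates and using Hoelder's inequality
    r <= |Gamma(z,r)| <= ||w chi_Gamma(z,r)||_X ||chi_Gamma(z,r)/w||_X'
  yields the A_X bound at t. Large r reduce to small r by compactness. The tangent has modulus one
  almost everywhere because a Lipschitz function is the integral of its derivative, so that the length L
  is at most the integral over [0,L] of the speed of the arc-length parametrization, a speed at most 1.
*)
theory Submission
  imports Defs
begin

section \<open>Differentiation of Lipschitz functions\<close>

text \<open>On Gamma(t,r) itself the kernel 1/(tau - x) turns through all directions, so no lower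
  bound for |S f| can be read off there; a second, disjoint disc is forced. Centres 3r apart and
  radii r put every difference tau - x in the disc of radius 2r about the difference of the centres,
  which stays away from 0. This fixes all constants. A single such estimate relates norms over two
  different discs. In the product with the exchanged one, the two factors that belong to Gamma(z,r)
  can be removed because together they are at least r. They are then also nonzero, and this gives
  finiteness of the factors at t, which is not known beforehand.

  The phase has to be a Borel function on the curve that cancels \<open>vector_derivative\<close>
  almost everywhere. Hence the preliminary work: almost everywhere differentiability of Lipschitz
  maps with the integral representation (by Radon-Nikodym), and Borel measurability of the inverse
  of the parametrization. As the length measure is complete, weights and test functions are replaced
  by Borel representatives before they are composed with \<open>\<gamma>\<close>.\<close>

lemma AE_lborel_negligible:
  fixes N :: "'a::euclidean_space set"
  assumes "negligible N" "\<And>x. x \<notin> N \<Longrightarrow> P x"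
  shows "AE x in lborel. P x"
proof -
  have "AE x in lebesgue. P x"
    using assms by (intro AE_I'[of N]) (auto simp: negligible_iff_null_sets)
  then show ?thesis by (simp add: AE_completion_iff)
qed

lemma negligible_AE_lborel:
  assumes "AE x in lborel. P x"
  shows "negligible {x. \<not> P x}"
proof -
  obtain N where N: "N \<in> null_sets lborel" "{x \<in> space lborel. \<not> P x} \<subseteq> N"
    using assms by (auto simp: eventually_ae_filter)
  from N(1) have "N \<in> null_sets lebesgue" by (rule null_sets_completionI)
  then show ?thesis using N(2)
    by (auto simp: negligible_iff_null_sets intro: null_sets_completion_subset)
qed

text \<open>Lebesgue differentiation in the form used here controls averages over [x, x + h] only,
  that is, the right derivative. The left derivative comes from the same statement for f(-x), whose
  exceptional set is reflected back.\<close>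

lemma indefinite_integral_has_vector_derivative_AE:
  fixes f F :: "real \<Rightarrow> 'a::euclidean_space"
  assumes int: "\<And>a b. a \<le> b \<Longrightarrow> (f has_integral (F b - F a)) {a..b}"
  shows "AE x in lborel. (F has_vector_derivative f x) (at x)"
proof -
  have i1: "f integrable_on cbox a b" for a b
    using int[of a b] by (cases "a \<le> b") auto
  have int2: "((\<lambda>x. f (- x)) has_integral (F (- a) - F (- b))) {a..b}" if "a \<le> b" for a b
    using int[of "-b" "-a"] that has_integral_reflect_real[where f=f and a="-b" and b="-a"] by simp
  have i2: "(\<lambda>x. f (- x)) integrable_on cbox a b" for a b
    using int2[of a b] by (cases "a \<le> b") auto
  obtain N1 where N1: "negligible N1"
    "\<And>x e. \<lbrakk>x \<notin> N1; 0 < e\<rbrakk> \<Longrightarrow> \<exists>d>0. \<forall>h. 0 < h \<and> h < d \<longrightarrow>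
       norm(integral (cbox x (x + h *\<^sub>R One)) f /\<^sub>R h ^ DIM(real) - f x) < e"
    using integrable_ccontinuous_explicit[OF i1] by blast
  obtain N2 where N2: "negligible N2"
    "\<And>x e. \<lbrakk>x \<notin> N2; 0 < e\<rbrakk> \<Longrightarrow> \<exists>d>0. \<forall>h. 0 < h \<and> h < d \<longrightarrow>
       norm(integral (cbox x (x + h *\<^sub>R One)) (\<lambda>x. f (- x)) /\<^sub>R h ^ DIM(real) - f (- x)) < e"
    using integrable_ccontinuous_explicit[OF i2] by blast
  have "negligible (uminus ` N2)"
    using N2(1) by (rule negligible_locally_Lipschitz_image[rotated])
      (auto intro!: exI[of _ UNIV] exI[of _ "1::real"] simp: abs_minus_commute)
  then have neg: "negligible (N1 \<union> uminus ` N2)" using N1(1) by auto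
  show ?thesis
  proof (rule AE_lborel_negligible[OF neg])
    fix x assume x: "x \<notin> N1 \<union> uminus ` N2"
    have x2: "- x \<notin> N2" using x by force
    show "(F has_vector_derivative f x) (at x)"
      unfolding has_vector_derivative_def has_derivative_at_alt
    proof (intro conjI allI impI)
      show "bounded_linear (\<lambda>h. h *\<^sub>R f x)" by (rule bounded_linear_scaleR_left)
      fix e :: real assume e: "e > 0"
      have I1: "integral {x..x + h} f = F (x + h) - F x" if "h > 0" for h
        using that by (intro integral_unique int) auto
      have I2: "integral {- x..h - x} (\<lambda>x. f (- x)) = F x - F (x - h)" if "h > 0" for h
        using integral_unique[OF int2[of "-x" "h - x"]] that by simp
      obtain d1 where d1: "d1 > 0" "\<And>h. 0 < h \<Longrightarrow> h < d1 \<Longrightarrow> norm((F (x + h) - F x) /\<^sub>R h - f x) < e"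
        using N1(2)[of x e] x e I1 by auto
      obtain d2 where d2: "d2 > 0" "\<And>h. 0 < h \<Longrightarrow> h < d2 \<Longrightarrow> norm((F x - F (x - h)) /\<^sub>R h - f x) < e"
        using N2(2)[of "-x" e] x2 e I2 by auto
      have key: "norm (D - h *\<^sub>R v) \<le> e * h" if "norm (D /\<^sub>R h - v) < e" "h > 0" for D v :: 'a and h
      proof -
        have "D - h *\<^sub>R v = h *\<^sub>R (D /\<^sub>R h - v)" using that by (simp add: algebra_simps)
        then have "norm (D - h *\<^sub>R v) = h * norm (D /\<^sub>R h - v)"
          using that by (metis norm_scaleR abs_of_pos)
        then show ?thesis using that by (simp add: mult.commute)
      qed
      show "\<exists>d>0. \<forall>y. norm (y - x) < d \<longrightarrow> norm (F y - F x - (y - x) *\<^sub>R f x) \<le> e * norm (y - x)"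
      proof (intro exI[of _ "min d1 d2"] conjI allI impI)
        show "0 < min d1 d2" using d1 d2 by auto
        fix y assume y: "norm (y - x) < min d1 d2"
        consider "y = x" | "y > x" | "y < x" by linarith
        then show "norm (F y - F x - (y - x) *\<^sub>R f x) \<le> e * norm (y - x)"
        proof cases
          case 2
          then show ?thesis using key[OF d1(2)[of "y - x"]] y by simp
        next
          case 3
          then have "norm (F x - F y - (x - y) *\<^sub>R f x) \<le> e * (x - y)"
            using key[OF d2(2)[of "x - y"]] y by simp
          moreover have "F y - F x - (y - x) *\<^sub>R f x = - (F x - F y - (x - y) *\<^sub>R f x)"
            by (simp add: algebra_simps)
          ultimately show ?thesis using 3 by (metis norm_minus_cancel real_norm_def abs_minus_commute abs_of_pos diff_gt_0_iff_gt)
        qed simp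
      qed
    qed
  qed
qed

text \<open>For real-valued \<open>F\<close> the function \<open>G x = F x + 2 x\<close> is a bi-Lipschitz bijection of the line, so the
  image of Lebesgue measure under its inverse is absolutely continuous.\<close>

lemma lipschitz_real_has_integral:
  fixes F :: "real \<Rightarrow> real"
  assumes lip: "\<And>x y. \<bar>F x - F y\<bar> \<le> \<bar>x - y\<bar>"
  obtains \<phi> :: "real \<Rightarrow> real" where "\<phi> \<in> borel_measurable borel"
    "\<And>a b. a \<le> b \<Longrightarrow> (\<phi> has_integral (F b - F a)) {a..b}"
proof -
  \<comment> \<open>The slope 2 exceeds the Lipschitz constant 1 of \<open>F\<close>, so all
    difference quotients of \<open>G\<close> lie between 1 and 3.\<close>
  define G where "G x = F x + 2 * x" for x
  have G1: "y - x \<le> G y - G x" if "x \<le> y" for x y using lip[of y x] that by (auto simp: G_def)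
  have G2: "\<bar>G y - G x\<bar> \<le> 3 * \<bar>y - x\<bar>" for x y
    using lip[of y x] unfolding G_def by (smt (verit))
  have contG: "continuous_on S G" for S
  proof (rule continuous_on_subset[OF _ subset_UNIV])
    have "3-lipschitz_on UNIV G" by (rule lipschitz_onI) (auto simp: dist_real_def G2)
    then show "continuous_on UNIV G" by (rule lipschitz_on_continuous_on)
  qed
  have surj: "\<exists>x. G x = y" for y
  proof -
    define r where "r = \<bar>y - G 0\<bar>"
    have "G (- r) \<le> y" "y \<le> G r" using G1[of "-r" 0] G1[of 0 r] by (auto simp: r_def)
    then show ?thesis using IVT'[of G "-r" y r] contG by (auto simp: r_def)
  qed
  have mono: "G x < G y \<longleftrightarrow> x < y" for x y
    using G1[of x y] G1[of y x] by force
  have inj: "inj G" by (rule injI) (metis mono less_irrefl linorder_neqE)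
  have bij: "bij G" using inj surj by (auto simp: bij_def surj_def) metis
  define H where "H = inv G"
  have HG: "H (G x) = x" "G (H y) = y" for x y
    using bij by (auto simp: H_def bij_def surj_f_inv_f)
  have lipH: "\<bar>H x - H y\<bar> \<le> \<bar>x - y\<bar>" for x y
    using G1[of "H x" "H y"] G1[of "H y" "H x"] by (cases "H x \<le> H y") (auto simp: HG)
  have "1-lipschitz_on UNIV H" by (rule lipschitz_onI) (auto simp: dist_real_def lipH)
  then have "continuous_on UNIV H" by (rule lipschitz_on_continuous_on)
  then have Hm [measurable]: "H \<in> borel_measurable borel" by (rule borel_measurable_continuous_onI)
  \<comment> \<open>\<open>\<mu>\<close> gives an interval the length of its image under
    \<open>G\<close>, which is the increment of \<open>G\<close>; its density therefore plays the
    role of the derivative of \<open>G\<close>.\<close>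
  define \<mu> where "\<mu> = distr lborel lborel H"
  have vimage: "H -` A = G ` A" for A
    using HG by (auto simp: image_iff) metis
  have "absolutely_continuous lborel \<mu>"
    unfolding absolutely_continuous_def
  proof
    fix N :: "real set" assume N: "N \<in> null_sets lborel"
    then have [measurable]: "N \<in> sets borel" by auto
    have "negligible N" using N by (auto simp: negligible_iff_null_sets intro: null_sets_completionI)
    then have "negligible (G ` N)"
      by (rule negligible_locally_Lipschitz_image[rotated])
         (use G2 in \<open>auto intro!: exI[of _ UNIV] exI[of _ 3]\<close>)
    then have "G ` N \<in> null_sets lebesgue" by (simp add: negligible_iff_null_sets)
    moreover have "H -` N \<in> sets lborel" using measurable_sets[OF Hm, of N] by simp
    ultimately have "emeasure lborel (H -` N) = 0" using vimage by auto
    then show "N \<in> null_sets \<mu>" by (auto simp: null_sets_def \<mu>_def emeasure_distr)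
  qed
  then obtain f where f [measurable]: "f \<in> borel_measurable lborel" and f\<mu>: "density lborel f = \<mu>"
    using sigma_finite_measure.Radon_Nikodym[OF sigma_finite_lborel, of \<mu>] by (auto simp: \<mu>_def)
  have fint: "(\<integral>\<^sup>+x. f x * indicator {a..b} x \<partial>lborel) = ennreal (G b - G a)" if "a \<le> b" for a b
  proof -
    have "(\<integral>\<^sup>+x. f x * indicator {a..b} x \<partial>lborel) = emeasure \<mu> {a..b}"
      by (subst f\<mu>[symmetric], subst emeasure_density) auto
    also have "\<dots> = emeasure lborel (H -` {a..b})" by (simp add: \<mu>_def emeasure_distr)
    also have "H -` {a..b} = {G a..G b}"
    proof (intro set_eqI iffI)
      fix y assume "y \<in> H -` {a..b}"
      then show "y \<in> {G a..G b}" using mono[of "H y" a] mono[of b "H y"] by (auto simp: HG not_less[symmetric])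
    next
      fix y assume "y \<in> {G a..G b}"
      then show "y \<in> H -` {a..b}" using mono[of "H y" a] mono[of b "H y"] by (auto simp: HG not_less[symmetric])
    qed
    also have "emeasure lborel {G a..G b} = ennreal (G b - G a)"
      using that G1[of a b] by simp
    finally show ?thesis .
  qed
  \<comment> \<open>The Radon-Nikodym density may take the value infinity, which
    \<open>enn2real\<close> would turn into 0. Finite integrals over the intervals [-n, n] confine
    this to a null set.\<close>
  have "AE x in lborel. f x * indicator {- real n..real n} x \<noteq> \<infinity>" for n :: nat
    by (rule nn_integral_noteq_infinite) (auto simp: fint)
  then have "AE x in lborel. \<forall>n. f x * indicator {- real n..real n} x \<noteq> \<infinity>"
    by (simp add: AE_all_countable)
  then have fin: "AE x in lborel. f x < \<infinity>"
  proof eventually_elim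
    case (elim x)
    obtain n where "\<bar>x\<bar> \<le> real n" using real_arch_simple by blast
    then have "x \<in> {- real n..real n}" by auto
    then show ?case using elim[rule_format, of n] by (auto simp: top.not_eq_extremum)
  qed
  define \<phi> where "\<phi> x = enn2real (f x) - 2" for x
  show ?thesis
  proof
    show "\<phi> \<in> borel_measurable borel" using f by (simp add: \<phi>_def[abs_def])
    fix a b :: real assume ab: "a \<le> b"
    have "(\<integral>\<^sup>+x. ennreal (enn2real (f x) * indicator {a..b} x) \<partial>lborel) = ennreal (G b - G a)"
      unfolding fint[OF ab, symmetric]
      by (rule nn_integral_cong_AE, use fin in eventually_elim) (auto simp: indicator_def)
    then have "((\<lambda>x. enn2real (f x) * indicator {a..b} x) has_integral (G b - G a)) UNIV"
      using ab G1[of a b] f by (intro nn_integral_has_integral) auto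
    also have "(\<lambda>x. enn2real (f x) * indicator {a..b} x) = (\<lambda>x. if x \<in> {a..b} then enn2real (f x) else 0)"
      by auto
    finally have "((\<lambda>x. enn2real (f x)) has_integral (G b - G a)) {a..b}"
      by (simp only: has_integral_restrict_UNIV)
    moreover have "((\<lambda>x::real. 2::real) has_integral (2 * (b - a))) {a..b}"
      using has_integral_const_real[of "2::real" a b] ab by (simp add: algebra_simps)
    ultimately have "(\<phi> has_integral (G b - G a - 2 * (b - a))) {a..b}"
      unfolding \<phi>_def by (rule has_integral_diff)
    then show "(\<phi> has_integral (F b - F a)) {a..b}" by (simp add: G_def algebra_simps)
  qed
qed

lemma norm_vector_derivative_le_lipschitz:
  fixes F :: "real \<Rightarrow> 'a::real_normed_vector"
  assumes lip: "\<And>x y. norm (F x - F y) \<le> \<bar>x - y\<bar>"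
    and der: "(F has_vector_derivative v) (at x)"
  shows "norm v \<le> 1"
proof (rule field_le_epsilon)
  fix e :: real assume "e > 0"
  then obtain d where d: "d > 0" "\<And>y. norm (y - x) < d \<Longrightarrow>
      norm (F y - F x - (y - x) *\<^sub>R v) \<le> e * norm (y - x)"
    using der unfolding has_vector_derivative_def has_derivative_at_alt by metis
  have "norm ((d/2) *\<^sub>R v) \<le> norm (F (x + d/2) - F x) + norm (F (x + d/2) - F x - (d/2) *\<^sub>R v)"
    using norm_triangle_ineq4[of "F (x + d/2) - F x" "F (x + d/2) - F x - (d/2) *\<^sub>R v"] by simp
  also have "\<dots> \<le> d/2 + e * (d/2)"
    using lip[of "x + d/2" x] d(2)[of "x + d/2"] d(1) by auto
  also have "\<dots> = (d/2) * (1 + e)" by (simp add: algebra_simps)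
  finally have "(d/2) * norm v \<le> (d/2) * (1 + e)" using d(1) by simp
  then show "norm v \<le> 1 + e" using d(1) by (simp only: mult_le_cancel_left_pos)
qed

text \<open>Real and imaginary parts are represented as integrals separately; differentiating the
  combined integral then identifies the integrand with the derivative almost everywhere.\<close>

lemma lipschitz_complex_derivative:
  fixes F :: "real \<Rightarrow> complex"
  assumes lip: "\<And>x y. cmod (F x - F y) \<le> \<bar>x - y\<bar>"
  obtains \<phi> :: "real \<Rightarrow> complex" where "\<phi> \<in> borel_measurable borel" "\<And>x. cmod (\<phi> x) \<le> 1"
    "AE x in lborel. (F has_vector_derivative \<phi> x) (at x)"
    "\<And>a b. a \<le> b \<Longrightarrow> (\<phi> has_integral (F b - F a)) {a..b}"
proof -
  have "\<bar>Re (F x) - Re (F y)\<bar> \<le> \<bar>x - y\<bar>" "\<bar>Im (F x) - Im (F y)\<bar> \<le> \<bar>x - y\<bar>" for x y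
    using lip[of x y] abs_Re_le_cmod[of "F x - F y"] abs_Im_le_cmod[of "F x - F y"] by auto
  then obtain r i where ri: "r \<in> borel_measurable borel" "i \<in> borel_measurable borel"
    "\<And>a b. a \<le> b \<Longrightarrow> (r has_integral (Re (F b) - Re (F a))) {a..b}"
    "\<And>a b. a \<le> b \<Longrightarrow> (i has_integral (Im (F b) - Im (F a))) {a..b}"
    by (metis lipschitz_real_has_integral[of "\<lambda>x. Re (F x)"] lipschitz_real_has_integral[of "\<lambda>x. Im (F x)"])
  define p where "p x = Complex (r x) (i x)" for x
  have [measurable]: "p \<in> borel_measurable borel"
    unfolding p_def Complex_eq using ri by measurable
  have pint: "(p has_integral (F b - F a)) {a..b}" if "a \<le> b" for a b
    using has_integral_add[OF has_integral_linear[OF ri(3)[OF that] bounded_linear_of_real]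
        has_integral_mult_right[OF has_integral_linear[OF ri(4)[OF that] bounded_linear_of_real], of \<i>]]
    by (simp add: p_def[abs_def] Complex_eq o_def complex_eq_iff algebra_simps flip: complex_eq)
  have pder: "AE x in lborel. (F has_vector_derivative p x) (at x)"
    by (rule indefinite_integral_has_vector_derivative_AE[OF pint])
  then have ple: "AE x in lborel. cmod (p x) \<le> 1"
    by eventually_elim (rule norm_vector_derivative_le_lipschitz[OF lip])
  \<comment> \<open>Truncation turns the almost everywhere bound into one valid at every point; it
    changes \<open>p\<close> only on a null set, so integrals and derivatives survive.\<close>
  define \<phi> where "\<phi> x = (if cmod (p x) \<le> 1 then p x else 0)" for x
  show ?thesis
  proof
    show "\<phi> \<in> borel_measurable borel" unfolding \<phi>_def by measurable
    show "cmod (\<phi> x) \<le> 1" for x by (simp add: \<phi>_def)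
    show "AE x in lborel. (F has_vector_derivative \<phi> x) (at x)"
      using pder ple by eventually_elim (simp add: \<phi>_def)
    show "(\<phi> has_integral (F b - F a)) {a..b}" if "a \<le> b" for a b
      by (rule has_integral_spike[OF negligible_AE_lborel[OF ple] _ pint[OF that]]) (simp add: \<phi>_def)
  qed
qed

section \<open>Arc length\<close>

lemma curve_length_upper:
  assumes "mono p" "range p \<subseteq> {a..b}"
  shows "(\<Sum>i<n. ennreal (dist (g (p i)) (g (p (Suc i))))) \<le> curve_length g a b"
  unfolding curve_length_def by (rule SUP_upper2[of "(n, p)"]) (use assms in auto)

lemma curve_length_least:
  assumes "\<And>n p. mono p \<Longrightarrow> range p \<subseteq> {a..b} \<Longrightarrow>
             (\<Sum>i<n. ennreal (dist (g (p i)) (g (p (Suc i))))) \<le> B"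
  shows "curve_length g a b \<le> B"
  unfolding curve_length_def by (rule SUP_least) (use assms in auto)

lemma dist_le_curve_length:
  assumes "a \<le> b"
  shows "ennreal (dist (g a) (g b)) \<le> curve_length g a b"
proof -
  have "mono (\<lambda>i::nat. if i = 0 then a else b)" "range (\<lambda>i::nat. if i = 0 then a else b) \<subseteq> {a..b}"
    using assms by (auto simp: mono_def)
  from curve_length_upper[OF this, of g 1] show ?thesis by simp
qed

text \<open>A partition of [a, c] is clipped at b from above and from below. At most the chord that
  crosses b is cut in two, and there the triangle inequality applies.\<close>

lemma curve_length_split_le:
  assumes "a \<le> b" "b \<le> c"
  shows "curve_length g a c \<le> curve_length g a b + curve_length g b c"
proof (rule curve_length_least)
  fix n and p :: "nat \<Rightarrow> real" assume p: "mono p" "range p \<subseteq> {a..c}"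
  define q r where "q i = min (p i) b" and "r i = max (p i) b" for i
  have q: "mono q" "range q \<subseteq> {a..b}" using p assms by (auto simp: q_def mono_def image_subset_iff min.coboundedI1 intro: min.mono)
  have r: "mono r" "range r \<subseteq> {b..c}" using p assms by (auto simp: r_def mono_def image_subset_iff max.coboundedI1 intro: max.mono)
  have "ennreal (dist (g (p i)) (g (p (Suc i))))
      \<le> ennreal (dist (g (q i)) (g (q (Suc i)))) + ennreal (dist (g (r i)) (g (r (Suc i))))" for i
  proof -
    have "p i \<le> p (Suc i)" using p(1) by (simp add: mono_def)
    then consider "p (Suc i) \<le> b" | "b \<le> p i" | "p i \<le> b" "b \<le> p (Suc i)" by linarith
    then have "dist (g (p i)) (g (p (Suc i)))
      \<le> dist (g (q i)) (g (q (Suc i))) + dist (g (r i)) (g (r (Suc i)))"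
      using \<open>p i \<le> p (Suc i)\<close>
      by cases (auto simp: q_def r_def min_def max_def intro: dist_triangle)
    then show ?thesis by (simp add: ennreal_plus[symmetric] ennreal_leI del: ennreal_plus)
  qed
  then have "(\<Sum>i<n. ennreal (dist (g (p i)) (g (p (Suc i)))))
      \<le> (\<Sum>i<n. ennreal (dist (g (q i)) (g (q (Suc i))))) + (\<Sum>i<n. ennreal (dist (g (r i)) (g (r (Suc i)))))"
    unfolding sum.distrib[symmetric] by (rule sum_mono)
  also have "\<dots> \<le> curve_length g a b + curve_length g b c"
    using q r by (intro add_mono curve_length_upper)
  finally show "(\<Sum>i<n. ennreal (dist (g (p i)) (g (p (Suc i))))) \<le> curve_length g a b + curve_length g b c" .
qed

lemma curve_length_split_ge:
  assumes "a \<le> b" "b \<le> c"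
  shows "curve_length g a b + curve_length g b c \<le> curve_length g a c"
proof -
  have 1: "(\<Sum>i<n. ennreal (dist (g (p i)) (g (p (Suc i))))) + (\<Sum>i<m. ennreal (dist (g (q i)) (g (q (Suc i)))))
      \<le> curve_length g a c"
    if p: "mono p" "range p \<subseteq> {a..b}" and q: "mono q" "range q \<subseteq> {b..c}" for n m p q
  proof -
    \<comment> \<open>Indices up to n carry \<open>p\<close>, those from \<open>Suc n\<close> on
      carry \<open>q\<close>. The chord with index n joins \<open>p n\<close> to \<open>q 0\<close>;
      it belongs to neither sum and is dropped as nonnegative.\<close>
    define r where "r i = (if i \<le> n then p i else q (i - Suc n))" for i
    have pb: "a \<le> p i" "p i \<le> b" "b \<le> q i" "q i \<le> c" for i using p q by (auto simp: image_subset_iff)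
    have r: "mono r"
      unfolding mono_def
    proof (intro allI impI)
      fix i j :: nat assume "i \<le> j"
      then show "r i \<le> r j"
        using p(1) q(1) order_trans[OF pb(2) pb(3)] by (auto simp: r_def mono_def)
    qed
    have rr: "range r \<subseteq> {a..c}"
      using pb order_trans[OF pb(2) assms(2)] order_trans[OF assms(1) pb(3)] by (auto simp: r_def)
    have "(\<Sum>i<n. ennreal (dist (g (p i)) (g (p (Suc i))))) = (\<Sum>i<n. ennreal (dist (g (r i)) (g (r (Suc i)))))"
      by (rule sum.cong) (auto simp: r_def)
    moreover have "(\<Sum>i<m. ennreal (dist (g (q i)) (g (q (Suc i)))))
        = (\<Sum>i<m. ennreal (dist (g (r (i + Suc n))) (g (r (Suc (i + Suc n))))))"
      by (rule sum.cong) (auto simp: r_def)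
    moreover have "(\<Sum>i<m. ennreal (dist (g (r (i + Suc n))) (g (r (Suc (i + Suc n))))))
        = (\<Sum>i\<in>{Suc n..<m + Suc n}. ennreal (dist (g (r i)) (g (r (Suc i)))))"
      using sum.shift_bounds_nat_ivl[of "\<lambda>i. ennreal (dist (g (r i)) (g (r (Suc i))))" 0 "Suc n" m]
      by (simp add: atLeast0LessThan)
    moreover have "(\<Sum>i<n. ennreal (dist (g (r i)) (g (r (Suc i)))))
        + (\<Sum>i\<in>{Suc n..<m + Suc n}. ennreal (dist (g (r i)) (g (r (Suc i)))))
        = (\<Sum>i\<in>{..<n} \<union> {Suc n..<m + Suc n}. ennreal (dist (g (r i)) (g (r (Suc i)))))"
      by (rule sum.union_disjoint[symmetric]) auto
    moreover have "\<dots> \<le> (\<Sum>i<m + Suc n. ennreal (dist (g (r i)) (g (r (Suc i)))))"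
      by (rule sum_mono2) auto
    moreover have "\<dots> \<le> curve_length g a c" by (rule curve_length_upper[OF r rr])
    ultimately show ?thesis by simp
  qed
  have ne: "{(n::nat, p::nat \<Rightarrow> real). mono p \<and> range p \<subseteq> {x..y}} \<noteq> {}" if "x \<le> y" for x y
    using that by (auto intro!: exI[of _ "\<lambda>_. x"] simp: mono_def)
  have 2: "(\<Sum>i<n. ennreal (dist (g (p i)) (g (p (Suc i))))) + curve_length g b c \<le> curve_length g a c"
    if p: "mono p" "range p \<subseteq> {a..b}" for n p
    unfolding curve_length_def[of g b c] using ne[OF assms(2)]
    by (subst ennreal_SUP_add_right) (auto intro!: SUP_least 1 that simp del: sum_ennreal)
  show ?thesis
    unfolding curve_length_def[of g a b] using ne[OF assms(1)]
    by (subst ennreal_SUP_add_left[symmetric]) (auto intro!: SUP_least 2 simp del: sum_ennreal)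
qed

lemma curve_length_split:
  assumes "a \<le> b" "b \<le> c"
  shows "curve_length g a c = curve_length g a b + curve_length g b c"
  using assms by (intro antisym curve_length_split_le curve_length_split_ge)

lemma curve_length_refl [simp]: "curve_length g a a = 0"
proof -
  have "curve_length g a a \<le> 0"
  proof (rule curve_length_least)
    fix n and p :: "nat \<Rightarrow> real" assume "range p \<subseteq> {a..a}"
    then have "p i = a" for i by (auto simp: image_subset_iff)
    then show "(\<Sum>i<n. ennreal (dist (g (p i)) (g (p (Suc i))))) \<le> 0" by simp
  qed
  then show ?thesis by simp
qed

text \<open>The length is a supremum of functionals that depend continuously on the end points.\<close>

lemma curve_length_lower_semicontinuous:
  assumes g: "continuous_on {0..1} g" and l: "continuous_on {0..1} l" and u: "continuous_on {0..1} u"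
    and lu: "\<And>y. y \<in> {0..1} \<Longrightarrow> 0 \<le> l y \<and> l y \<le> u y \<and> u y \<le> 1"
    and x: "x \<in> {0..1}" and r: "r < curve_length g (l x) (u x)"
  shows "\<forall>\<^sub>F y in at x within {0..1}. r < curve_length g (l y) (u y)"
proof -
  obtain n p where p: "mono p" "range p \<subseteq> {l x..u x}"
    and r': "r < (\<Sum>i<n. ennreal (dist (g (p i)) (g (p (Suc i)))))"
    using r unfolding curve_length_def less_SUP_iff by auto
  \<comment> \<open>A partition that is nearly optimal at x is clamped into [l y, u y]. It is
    unchanged at y = x and depends continuously on y, so its polygon length does too.\<close>
  define c where "c y t = max (l y) (min t (u y))" for y t
  have c01: "c y t \<in> {l y..u y}" if "y \<in> {0..1}" for y t
    using lu[OF that] by (auto simp: c_def)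
  have cx: "c x (p i) = p i" for i
    using p(2) by (auto simp: c_def image_subset_iff)
  have cont: "continuous_on {0..1} (\<lambda>y. g (c y t))" for t
  proof (rule continuous_on_compose2[OF g])
    show "continuous_on {0..1} (\<lambda>y. c y t)" unfolding c_def by (intro continuous_intros l u)
    show "(\<lambda>y. c y t) ` {0..1} \<subseteq> {0..1}" using c01[of _ t] lu by (force simp: image_subset_iff)
  qed
  define S where "S y = (\<Sum>i<n. ennreal (dist (g (c y (p i))) (g (c y (p (Suc i))))))" for y
  have "continuous_on {0..1} S" unfolding S_def
    by (intro continuous_on_sum continuous_on_ennreal continuous_intros cont)
  then have "(S \<longlongrightarrow> S x) (at x within {0..1})" using x by (simp add: continuous_on_def)
  moreover have "r < S x" using r' by (simp add: S_def cx)
  ultimately have "\<forall>\<^sub>F y in at x within {0..1}. r < S y" by (rule order_tendstoD)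
  moreover have "\<forall>\<^sub>F y in at x within {0..1}. y \<in> {0..1}"
    by (simp add: eventually_at_filter)
  ultimately show ?thesis
  proof eventually_elim
    case (elim y)
    have "S y \<le> curve_length g (l y) (u y)"
      unfolding S_def
    proof (rule curve_length_upper)
      show "mono (\<lambda>i. c y (p i))" 
        using p(1) unfolding c_def mono_def by (intro allI impI max.mono min.mono) auto
      show "range (\<lambda>i. c y (p i)) \<subseteq> {l y..u y}" using c01[OF elim(2)] by auto
    qed
    then show ?case using elim(1) by simp
  qed
qed

section \<open>Arc-length parametrization of a rectifiable Jordan curve\<close>

locale rectifiable_jordan =
  fixes g :: "real \<Rightarrow> complex"
  assumes rect: "rectifiable_jordan_curve g"
begin

abbreviation "\<Gamma> \<equiv> path_image g"
abbreviation "\<gamma> \<equiv> arc_length_param g"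
abbreviation "L \<equiv> total_length g"

lemma continuous_g: "continuous_on {0..1} g"
  and loop_free_g: "\<And>x y. x \<in> {0..1} \<Longrightarrow> y \<in> {0..1} \<Longrightarrow> g x = g y \<Longrightarrow> x = y \<or> x = 0 \<and> y = 1 \<or> x = 1 \<and> y = 0"
  and g01: "g 1 = g 0"
  and finite_length: "curve_length g 0 1 < \<infinity>"
  using rect by (auto simp: rectifiable_jordan_curve_def simple_path_def path_def loop_free_def
      pathstart_def pathfinish_def)

lemma curve_length_finite:
  assumes "0 \<le> x" "x \<le> y" "y \<le> 1"
  shows "curve_length g x y < \<infinity>"
proof -
  have "curve_length g x y \<le> curve_length g x 1" using assms by (simp add: curve_length_split[of x y 1])
  also have "\<dots> \<le> curve_length g 0 1" using assms by (simp add: curve_length_split[of 0 x 1])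
  finally show ?thesis using finite_length by simp
qed

lemma arc_length_diff:
  assumes "0 \<le> x" "x \<le> y" "y \<le> 1"
  shows "curve_length g x y = ennreal (arc_length g y - arc_length g x)" "arc_length g x \<le> arc_length g y"
proof -
  have e: "enn2real (curve_length g 0 y) = enn2real (curve_length g 0 x) + enn2real (curve_length g x y)"
    using assms curve_length_finite[of 0 x] curve_length_finite[of x y]
    by (simp add: curve_length_split[of 0 x y] enn2real_plus)
  then have "arc_length g y - arc_length g x = enn2real (curve_length g x y)"
    by (simp add: arc_length_def)
  then show "curve_length g x y = ennreal (arc_length g y - arc_length g x)"
    using curve_length_finite[OF assms] by simp
  show "arc_length g x \<le> arc_length g y" using e by (simp add: arc_length_def)
qed

lemma dist_le_arc_length:
  assumes "0 \<le> x" "x \<le> y" "y \<le> 1"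
  shows "dist (g x) (g y) \<le> arc_length g y - arc_length g x"
  using dist_le_curve_length[OF assms(2), of g] arc_length_diff[OF assms] by simp

lemma arc_length_strict_mono:
  assumes "0 \<le> x" "x < y" "y \<le> 1"
  shows "arc_length g x < arc_length g y"
proof -
  \<comment> \<open>For x = 0 and y = 1 the end points of the chord coincide. The midpoint avoids
    this exceptional pair.\<close>
  define m where "m = (x + y) / 2"
  have m: "x < m" "m < y" "0 < m" "m < 1" using assms by (auto simp: m_def)
  have "g x \<noteq> g m" using loop_free_g[of x m] m assms by auto
  then have "arc_length g x < arc_length g m" using dist_le_arc_length[of x m] m assms zero_less_dist_iff[of "g x" "g m"] by linarith
  also have "\<dots> \<le> arc_length g y" using arc_length_diff(2)[of m y] m assms by auto
  finally show ?thesis .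
qed

lemma arc_length_0 [simp]: "arc_length g 0 = 0"
  by (simp add: arc_length_def)

text \<open>The lengths of the arcs before and after y are both lower semicontinuous in y, and their
  sum is the constant \<open>L\<close>; so each is upper semicontinuous as well.\<close>

lemma continuous_arc_length: "continuous_on {0..1} (arc_length g)"
  unfolding continuous_on_def
proof (intro ballI tendstoI)
  fix x e :: real assume x: "x \<in> {0..1}" and e: "e > 0"
  have ev: "\<forall>\<^sub>F y in at x within {0..1}. y \<in> {0..1::real}"
    by (simp add: eventually_at_filter)
  have "\<forall>\<^sub>F y in at x within {0..1}. arc_length g x - e < arc_length g y"
  \<comment> \<open>\<open>ennreal\<close> sends negative reals to 0, so the comparison in
    \<open>ennreal\<close> is faithful only for a nonnegative bound. A negative bound is trivial
    because lengths are nonnegative.\<close>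
  proof (cases "arc_length g x - e < 0")
    case True
    from ev show ?thesis
    proof eventually_elim
      case (elim y)
      then have "0 \<le> arc_length g y" by (simp add: arc_length_def)
      then show ?case using True by simp
    qed
  next
    case False
    then have "ennreal (arc_length g x - e) < curve_length g 0 x"
      using x e arc_length_diff[of 0 x] by (simp add: ennreal_less_iff)
    then have "\<forall>\<^sub>F y in at x within {0..1}. ennreal (arc_length g x - e) < curve_length g 0 y"
      by (intro curve_length_lower_semicontinuous[OF continuous_g, of "\<lambda>_. 0" "\<lambda>y. y"] x)
         (auto intro: continuous_intros)
    then show ?thesis using ev
    proof eventually_elim
      case (elim y)
      then show ?case using False arc_length_diff[of 0 y] by (simp add: ennreal_less_iff)
    qed
  qed
  moreover have "\<forall>\<^sub>F y in at x within {0..1}. L - arc_length g x - e < L - arc_length g y"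
  proof (cases "L - arc_length g x - e < 0")
    case True
    from ev show ?thesis
    proof eventually_elim
      case (elim y)
      then have "0 \<le> L - arc_length g y" using arc_length_diff[of y 1] by (simp add: total_length_def)
      then show ?case using True by simp
    qed
  next
    case False
    then have "ennreal (L - arc_length g x - e) < curve_length g x 1"
      using x e arc_length_diff[of x 1] by (simp add: ennreal_less_iff total_length_def)
    then have "\<forall>\<^sub>F y in at x within {0..1}. ennreal (L - arc_length g x - e) < curve_length g y 1"
      by (intro curve_length_lower_semicontinuous[OF continuous_g, of "\<lambda>y. y" "\<lambda>_. 1"] x)
         (auto intro: continuous_intros)
    then show ?thesis using ev
    proof eventually_elim
      case (elim y)
      then show ?case using False arc_length_diff[of y 1] by (simp add: ennreal_less_iff total_length_def)
    qed
  qed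
  ultimately show "\<forall>\<^sub>F y in at x within {0..1}. dist (arc_length g y) (arc_length g x) < e"
    by eventually_elim (auto simp: dist_real_def)
qed

lemma L_pos: "0 < L"
  using arc_length_strict_mono[of 0 1] by (simp add: total_length_def)

lemma inj_arc_length: "inj_on (arc_length g) {0..1}"
  by (rule inj_onI) (metis arc_length_strict_mono atLeastAtMost_iff less_irrefl linorder_neqE)

lemma arc_length_image: "arc_length g ` {0..1} = {0..L}"
proof (intro subset_antisym subsetI)
  fix s assume "s \<in> arc_length g ` {0..1}"
  then show "s \<in> {0..L}"
    using arc_length_diff(2)[of 0] arc_length_diff(2)[of _ 1] by (auto simp: total_length_def)
next
  fix s assume "s \<in> {0..L}"
  then show "s \<in> arc_length g ` {0..1}"
    using IVT'[of "arc_length g" 0 s 1] continuous_arc_length by (auto simp: total_length_def)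
qed

lemma arc_length_param_arc_length [simp]:
  assumes "x \<in> {0..1}"
  shows "\<gamma> (arc_length g x) = g x"
  using assms by (simp add: arc_length_param_def inv_into_f_f[OF inj_arc_length])

lemma arc_length_param_image: "\<gamma> ` {0..L} = \<Gamma>"
  unfolding arc_length_image[symmetric] path_image_def by (force simp: image_iff)

lemma arc_length_param_lipschitz:
  assumes "s \<in> {0..L}" "t \<in> {0..L}"
  shows "cmod (\<gamma> s - \<gamma> t) \<le> \<bar>s - t\<bar>"
proof -
  obtain x y where xy: "x \<in> {0..1}" "y \<in> {0..1}" "s = arc_length g x" "t = arc_length g y"
    using assms unfolding arc_length_image[symmetric] by auto
  show ?thesis
  proof (cases "x \<le> y")
    case True
    then show ?thesis using dist_le_arc_length[of x y] arc_length_diff(2)[of x y] xy by (simp add: dist_norm)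
  next
    case False
    then show ?thesis using dist_le_arc_length[of y x] arc_length_diff(2)[of y x] xy
      by (simp add: dist_norm norm_minus_commute)
  qed
qed

lemma arc_length_param_inj:
  assumes "s \<in> {0..<L}" "t \<in> {0..<L}" "\<gamma> s = \<gamma> t"
  shows "s = t"
proof -
  obtain x y where xy: "x \<in> {0..1}" "y \<in> {0..1}" "s = arc_length g x" "t = arc_length g y"
    using assms unfolding arc_length_image[symmetric] by (metis atLeastLessThan_iff atLeastAtMost_iff arc_length_image imageE less_imp_le)
  have "x \<noteq> 1" "y \<noteq> 1" using assms xy by (auto simp: total_length_def)
  then show ?thesis using loop_free_g[of x y] xy assms by auto
qed

lemma arc_length_param_ends: "\<gamma> L = \<gamma> 0"
  using arc_length_param_arc_length[of 0] arc_length_param_arc_length[of 1] g01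
  by (simp add: total_length_def)

lemma continuous_arc_length_param: "continuous_on {0..L} \<gamma>"
proof -
  have "1-lipschitz_on {0..L} \<gamma>"
    by (rule lipschitz_onI) (auto simp: dist_norm arc_length_param_lipschitz)
  then show ?thesis by (rule lipschitz_on_continuous_on)
qed

text \<open>A Borel function stands in for \<open>vector_derivative\<close>, so that it can later be
  composed with the inverse of the parametrization.\<close>

lemma arc_length_param_derivative:
  obtains \<phi> :: "real \<Rightarrow> complex" where "\<phi> \<in> borel_measurable borel" "\<And>s. cmod (\<phi> s) \<le> 1"
    "AE s in lborel. s \<in> {0..L} \<longrightarrow> vector_derivative \<gamma> (at s) = \<phi> s \<and> cmod (\<phi> s) = 1"
proof -
  \<comment> \<open>Clamping extends \<open>\<gamma>\<close> from [0, L] to a 1-Lipschitz map on the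
    whole line.\<close>
  define c where "c s = max 0 (min L s)" for s
  have c: "c s \<in> {0..L}" "\<bar>c s - c t\<bar> \<le> \<bar>s - t\<bar>" for s t using L_pos by (auto simp: c_def)
  have cid: "c s = s" if "s \<in> {0..L}" for s using that by (auto simp: c_def)
  have "cmod (\<gamma> (c s) - \<gamma> (c t)) \<le> \<bar>s - t\<bar>" for s t
    using arc_length_param_lipschitz[OF c(1) c(1), of s t] c(2)[of s t] by linarith
  from lipschitz_complex_derivative[of "\<lambda>s. \<gamma> (c s)", OF this]
  obtain \<phi> where \<phi> [measurable]: "\<phi> \<in> borel_measurable borel" and \<phi>1: "\<And>x. cmod (\<phi> x) \<le> 1"
    and der: "AE s in lborel. ((\<lambda>s. \<gamma> (c s)) has_vector_derivative \<phi> s) (at s)"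
    and int: "\<And>a b. a \<le> b \<Longrightarrow> (\<phi> has_integral (\<gamma> (c b) - \<gamma> (c a))) {a..b}"
    by blast
  have absint: "(\<lambda>s. cmod (\<phi> s)) integrable_on {a..b}" for a b
  proof -
    have "\<phi> absolutely_integrable_on {a..b}"
      by (rule measurable_bounded_by_integrable_imp_absolutely_integrable[where g="\<lambda>_. 1"])
         (auto simp: \<phi>1 intro!: borel_measurable_if_D measurable_completion)
    then show ?thesis unfolding absolutely_integrable_on_def by auto
  qed
  \<comment> \<open>\<open>I\<close> is the length obtained by integrating the speed. It dominates
    every chord, so an inscribed polygon telescopes to at most \<open>I L\<close>.\<close>
  define I where "I s = integral {0..s} (\<lambda>s. cmod (\<phi> s))" for s
  have I: "cmod (\<gamma> t - \<gamma> s) \<le> I t - I s" "I s \<le> I t" if "0 \<le> s" "s \<le> t" "t \<le> L" for s t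
  proof -
    have e: "I t - I s = integral {s..t} (\<lambda>s. cmod (\<phi> s))"
      using Henstock_Kurzweil_Integration.integral_combine[of 0 s t "\<lambda>s. cmod (\<phi> s)"] that absint
      by (simp add: I_def)
    have "\<gamma> t - \<gamma> s = integral {s..t} \<phi>"
      using integral_unique[OF int[of s t]] that by (simp add: cid)
    also have "cmod \<dots> \<le> integral {s..t} (\<lambda>s. cmod (\<phi> s))"
      using int[of s t] absint that by (intro integral_norm_bound_integral) auto
    finally show "cmod (\<gamma> t - \<gamma> s) \<le> I t - I s" by (simp add: e)
    then show "I s \<le> I t" using norm_ge_zero[of "\<gamma> t - \<gamma> s"] by linarith
  qed
  have I0: "I 0 = 0" by (simp add: I_def)
  have "curve_length g 0 1 \<le> ennreal (I L)"
  proof (rule curve_length_least)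
    fix n and p :: "nat \<Rightarrow> real" assume p: "mono p" "range p \<subseteq> {0..1}"
    define q where "q i = arc_length g (p i)" for i
    have p': "0 \<le> p i" "p i \<le> p (Suc i)" "p i \<le> 1" for i using p by (auto simp: image_subset_iff mono_def)
    have q: "q i \<in> {0..L}" for i
      using arc_length_image p' by (auto simp: q_def)
    have "dist (g (p i)) (g (p (Suc i))) \<le> I (q (Suc i)) - I (q i)" for i
    proof -
      have "\<gamma> (q i) = g (p i)" "\<gamma> (q (Suc i)) = g (p (Suc i))" using p' by (auto simp: q_def)
      moreover have "q i \<le> q (Suc i)" using p' by (auto simp: q_def intro: arc_length_diff)
      ultimately show ?thesis using I(1)[of "q i" "q (Suc i)"] q by (auto simp: dist_norm norm_minus_commute)
    qed
    then have "(\<Sum>i<n. dist (g (p i)) (g (p (Suc i)))) \<le> (\<Sum>i<n. I (q (Suc i)) - I (q i))"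
      by (rule sum_mono)
    also have "\<dots> = I (q n) - I (q 0)" by (rule sum_lessThan_telescope)
    also have "\<dots> \<le> I L" using I(2)[of 0 "q 0"] I(2)[of "q n" L] q I0 by auto
    finally show "(\<Sum>i<n. ennreal (dist (g (p i)) (g (p (Suc i))))) \<le> ennreal (I L)"
      by (simp add: sum_ennreal ennreal_leI)
  qed
  moreover have "0 \<le> I L" using I(2)[of 0 L] I0 L_pos by auto
  ultimately have LI: "L \<le> I L" using arc_length_diff(1)[of 0 1] by (simp add: total_length_def)
  \<comment> \<open>The function 1 - |phi| is nonnegative with integral at most 0, hence zero almost
    everywhere.\<close>
  have "((\<lambda>s. 1 - cmod (\<phi> s)) has_integral (L - I L)) {0..L}"
    unfolding I_def using has_integral_const_real[of "1::real" 0 L] L_pos absint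
    by (intro has_integral_diff) (auto simp: has_integral_integral[symmetric])
  then have "(\<integral>\<^sup>+s. indicator {0..L} s * (1 - cmod (\<phi> s)) \<partial>lborel) = ennreal (L - I L)"
    by (rule nn_integral_has_integral_lebesgue[rotated]) (simp add: \<phi>1)
  also have "\<dots> = 0" using LI by (simp add: ennreal_eq_0_iff)
  finally have "AE s in lborel. ennreal (indicator {0..L} s * (1 - cmod (\<phi> s))) = 0"
    by (subst (asm) nn_integral_0_iff_AE) auto
  then have one: "AE s in lborel. s \<in> {0..L} \<longrightarrow> cmod (\<phi> s) = 1"
  proof eventually_elim
    case (elim s)
    then show ?case using \<phi>1[of s] by (auto simp: ennreal_eq_0_iff)
  qed
  \<comment> \<open>The clamped map and \<open>\<gamma>\<close> are known to agree only on [0, L],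
    which is a neighbourhood of s just for interior s.\<close>
  have ends: "AE s in lborel. s \<noteq> 0 \<and> s \<noteq> L"
    using AE_lborel_singleton[of 0] AE_lborel_singleton[of L] by eventually_elim auto
  show ?thesis
  proof
    show "\<phi> \<in> borel_measurable borel" "\<And>s. cmod (\<phi> s) \<le> 1" by fact+
    show "AE s in lborel. s \<in> {0..L} \<longrightarrow> vector_derivative \<gamma> (at s) = \<phi> s \<and> cmod (\<phi> s) = 1"
      using der one ends
    proof eventually_elim
      case (elim s)
      show ?case
      proof
        assume s: "s \<in> {0..L}"
        then have "s \<in> {0<..<L}" using elim by auto
        then have "(\<gamma> has_vector_derivative \<phi> s) (at s)"
          by (intro has_vector_derivative_transform_within_open[OF elim(1), of "{0<..<L}"]) (auto simp: cid)
        then show "vector_derivative \<gamma> (at s) = \<phi> s \<and> cmod (\<phi> s) = 1"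
          using elim s by (auto intro: vector_derivative_at)
      qed
    qed
  qed
qed

end

section \<open>Banach function norms and duality\<close>

context
  fixes N :: "'a measure" and \<rho> :: "('a \<Rightarrow> ennreal) \<Rightarrow> ennreal"
  assumes bfn: "banach_function_norm N \<rho>"
begin

lemma bfn_eq_0_iff: "f \<in> borel_measurable N \<Longrightarrow> \<rho> f = 0 \<longleftrightarrow> (AE x in N. f x = 0)"
  and bfn_cmult: "f \<in> borel_measurable N \<Longrightarrow> 0 \<le> a \<Longrightarrow> \<rho> (\<lambda>x. ennreal a * f x) = ennreal a * \<rho> f"
  and bfn_add: "f \<in> borel_measurable N \<Longrightarrow> h \<in> borel_measurable N \<Longrightarrow> \<rho> (\<lambda>x. f x + h x) \<le> \<rho> f + \<rho> h"
  and bfn_mono: "f \<in> borel_measurable N \<Longrightarrow> h \<in> borel_measurable N \<Longrightarrow> (AE x in N. h x \<le> f x) \<Longrightarrow> \<rho> h \<le> \<rho> f"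
  and bfn_indicator: "E \<in> sets N \<Longrightarrow> \<rho> (indicator E) < \<infinity>"
  and bfn_integral: "E \<in> sets N \<Longrightarrow> \<exists>C::real. 0 < C \<and>
        (\<forall>f \<in> borel_measurable N. (\<integral>\<^sup>+x\<in>E. f x \<partial>N) \<le> ennreal C * \<rho> f)"
  using bfn unfolding banach_function_norm_def by blast+

lemma bfn_sum:
  assumes "finite I" "\<And>i. i \<in> I \<Longrightarrow> F i \<in> borel_measurable N"
  shows "\<rho> (\<lambda>x. \<Sum>i\<in>I. F i x) \<le> (\<Sum>i\<in>I. \<rho> (F i))"
  using assms
proof (induction I rule: finite_induct)
  case empty
  have "\<rho> (\<lambda>x. 0) = 0" by (subst bfn_eq_0_iff) auto
  then show ?case by simp
next
  case (insert i I)
  have "\<rho> (\<lambda>x. F i x + (\<Sum>i\<in>I. F i x)) \<le> \<rho> (F i) + \<rho> (\<lambda>x. \<Sum>i\<in>I. F i x)"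
    using insert by (intro bfn_add) auto
  also have "\<dots> \<le> \<rho> (F i) + (\<Sum>i\<in>I. \<rho> (F i))" using insert by (intro add_left_mono) auto
  finally show ?case using insert by simp
qed

text \<open>Property (A5) on the whole space makes \<open>f\<close> integrable.\<close>

lemma bfn_AE_finite:
  assumes "f \<in> borel_measurable N" "\<rho> f < \<infinity>"
  shows "AE x in N. f x < \<infinity>"
proof -
  obtain C :: real where "(\<integral>\<^sup>+x\<in>space N. f x \<partial>N) \<le> ennreal C * \<rho> f"
    using bfn_integral[of "space N"] assms by auto
  also have "\<dots> < \<infinity>" using assms by (simp add: ennreal_mult_less_top)
  also have "(\<integral>\<^sup>+x\<in>space N. f x \<partial>N) = (\<integral>\<^sup>+x. f x \<partial>N)" by (rule nn_integral_cong) simp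
  finally have "AE x in N. f x \<noteq> \<infinity>"
    by (intro nn_integral_noteq_infinite assms) auto
  then show ?thesis by eventually_elim (simp add: top.not_eq_extremum)
qed

lemma associate_norm_upper:
  "f \<in> borel_measurable N \<Longrightarrow> \<rho> f \<le> 1 \<Longrightarrow> (\<integral>\<^sup>+x. f x * h x \<partial>N) \<le> associate_norm N \<rho> h"
  unfolding associate_norm_def by (rule SUP_upper) auto

lemma associate_norm_sum:
  assumes I: "finite I" "\<And>i. i \<in> I \<Longrightarrow> H i \<in> borel_measurable N"
    and le: "\<And>x. x \<in> space N \<Longrightarrow> h x \<le> (\<Sum>i\<in>I. H i x)"
  shows "associate_norm N \<rho> h \<le> (\<Sum>i\<in>I. associate_norm N \<rho> (H i))"
  unfolding associate_norm_def[of _ _ h]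
proof (rule SUP_least)
  fix f assume f: "f \<in> {f \<in> borel_measurable N. \<rho> f \<le> 1}"
  have "(\<integral>\<^sup>+x. f x * h x \<partial>N) \<le> (\<integral>\<^sup>+x. (\<Sum>i\<in>I. f x * H i x) \<partial>N)"
    using le by (intro nn_integral_mono) (auto simp: sum_distrib_left[symmetric] intro: mult_left_mono)
  also have "\<dots> = (\<Sum>i\<in>I. \<integral>\<^sup>+x. f x * H i x \<partial>N)"
    using f I by (intro nn_integral_sum) auto
  also have "\<dots> \<le> (\<Sum>i\<in>I. associate_norm N \<rho> (H i))"
    using f by (intro sum_mono associate_norm_upper) auto
  finally show "(\<integral>\<^sup>+x. f x * h x \<partial>N) \<le> (\<Sum>i\<in>I. associate_norm N \<rho> (H i))" .
qed

text \<open>It suffices to test with one positive constant, whose norm is finite by (A4). The factor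
  1/(k + 1) instead of 1/k also covers a null space, where k = 0.\<close>

lemma associate_norm_eq_0:
  assumes h: "h \<in> borel_measurable N" and 0: "associate_norm N \<rho> h = 0"
  shows "AE x in N. h x = 0"
proof -
  define k where "k = enn2real (\<rho> (indicator (space N)))"
  have k: "\<rho> (indicator (space N)) = ennreal k" "0 \<le> k"
    using bfn_indicator[of "space N"] by (auto simp: k_def)
  define f :: "'a \<Rightarrow> ennreal" where "f x = ennreal (1 / (k + 1)) * indicator (space N) x" for x
  have f: "f \<in> borel_measurable N" unfolding f_def by measurable
  have "\<rho> f = ennreal (1 / (k + 1)) * ennreal k"
    unfolding f_def[abs_def] using k by (subst bfn_cmult) auto
  also have "\<dots> = ennreal (k / (k + 1))" using k(2) by (simp add: ennreal_mult[symmetric])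
  also have "\<dots> \<le> 1" using k(2) by (simp add: ennreal_le_1 divide_simps)
  finally have "(\<integral>\<^sup>+x. f x * h x \<partial>N) = 0" using associate_norm_upper[OF f, of h] 0 by simp
  then have "AE x in N. f x * h x = 0" using f h by (subst (asm) nn_integral_0_iff_AE) auto
  then show ?thesis
  proof (rule AE_mp, intro AE_I2 impI)
    fix x assume x: "x \<in> space N" "f x * h x = 0"
    have "f x \<noteq> 0" using x(1) k(2) by (simp add: f_def)
    then show "h x = 0" using x(2) by simp
  qed
qed

lemma associate_norm_holder:
  assumes f: "f \<in> borel_measurable N" and h: "h \<in> borel_measurable N"
  shows "(\<integral>\<^sup>+x. f x * h x \<partial>N) \<le> \<rho> f * associate_norm N \<rho> h"
proof -
  \<comment> \<open>In \<open>ennreal\<close> the product of 0 and infinity is 0, so a vanishing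
    factor on the right requires the left side to vanish even if the other factor is infinite. Only
    in the last case can \<open>f\<close> be scaled to norm one.\<close>
  consider "\<rho> f = 0" | "associate_norm N \<rho> h = 0" | "\<rho> f = \<infinity>" "associate_norm N \<rho> h \<noteq> 0"
    | "\<rho> f \<noteq> 0" "\<rho> f \<noteq> \<infinity>" by blast
  then show ?thesis
  proof cases
    case 1
    then have "AE x in N. f x * h x = 0" using bfn_eq_0_iff[OF f] by auto
    then have "(\<integral>\<^sup>+x. f x * h x \<partial>N) = 0" using f h by (subst nn_integral_0_iff_AE) auto
    then show ?thesis by simp
  next
    case 2
    then have "AE x in N. f x * h x = 0" using associate_norm_eq_0[OF h] by auto
    then have "(\<integral>\<^sup>+x. f x * h x \<partial>N) = 0" using f h by (subst nn_integral_0_iff_AE) auto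
    then show ?thesis by simp
  next
    case 3
    then show ?thesis by (simp add: ennreal_top_mult)
  next
    case 4
    then obtain k where k: "\<rho> f = ennreal k" "0 < k"
      by (cases "\<rho> f") (auto simp: zero_less_iff_neq_zero)
    have "\<rho> (\<lambda>x. ennreal (1 / k) * f x) = 1"
      using k by (subst bfn_cmult[OF f]) (auto simp: ennreal_mult[symmetric])
    then have "(\<integral>\<^sup>+x. ennreal (1 / k) * f x * h x \<partial>N) \<le> associate_norm N \<rho> h"
      using f by (intro associate_norm_upper) auto
    also have "(\<integral>\<^sup>+x. ennreal (1 / k) * f x * h x \<partial>N) = ennreal (1 / k) * (\<integral>\<^sup>+x. f x * h x \<partial>N)"
      using f h by (simp add: mult.assoc nn_integral_cmult)
    finally have "ennreal k * (ennreal (1 / k) * (\<integral>\<^sup>+x. f x * h x \<partial>N)) \<le> ennreal k * associate_norm N \<rho> h"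
      by (rule mult_left_mono) simp
    also have "ennreal k * (ennreal (1 / k) * (\<integral>\<^sup>+x. f x * h x \<partial>N)) = (\<integral>\<^sup>+x. f x * h x \<partial>N)"
      using k by (simp add: mult.assoc[symmetric] ennreal_mult[symmetric])
    finally show ?thesis using k by simp
  qed
qed

text \<open>On \<open>E\<close> the constant 1 factors as w times 1/w wherever 0 < w < infinity, and
  Hoelder's inequality applies.\<close>

lemma emeasure_le_weighted_norms:
  assumes w: "weight N w" and E: "E \<in> sets N"
  shows "emeasure N E \<le> \<rho> (\<lambda>x. w x * indicator E x) * associate_norm N \<rho> (\<lambda>x. indicator E x / w x)"
proof -
  have [measurable]: "w \<in> borel_measurable N" and ae: "AE x in N. 0 < w x \<and> w x < \<infinity>"
    using w by (auto simp: weight_def)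
  have "emeasure N E = (\<integral>\<^sup>+x. indicator E x \<partial>N)" using E by simp
  also have "\<dots> = (\<integral>\<^sup>+x. (w x * indicator E x) * (indicator E x / w x) \<partial>N)"
    by (rule nn_integral_cong_AE, use ae in eventually_elim)
       (auto simp: indicator_def ennreal_times_divide intro!: ennreal_divide_self[symmetric])
  also have "\<dots> \<le> \<rho> (\<lambda>x. w x * indicator E x) * associate_norm N \<rho> (\<lambda>x. indicator E x / w x)"
    using E by (intro associate_norm_holder) auto
  finally show ?thesis .
qed

end

section \<open>The length measure\<close>

context rectifiable_jordan
begin

text \<open>The image measure before completion. Functions measurable here can be pulled back by
  \<open>\<gamma>\<close>; those measurable for the completion have representatives here that agree
  almost everywhere.\<close>

definition borel_length_measure :: "complex measure" where
  "borel_length_measure = distr (restrict_space lborel {0..L}) (restrict_space borel \<Gamma>) \<gamma>"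

lemma length_measure_completion: "length_measure g = completion borel_length_measure"
  by (simp add: length_measure_def borel_length_measure_def)

lemma space_borel_length_measure [simp]: "space borel_length_measure = \<Gamma>"
  and sets_borel_length_measure: "sets borel_length_measure = sets (restrict_space borel \<Gamma>)"
  by (auto simp: borel_length_measure_def space_restrict_space)

lemma space_length_measure [simp]: "space (length_measure g) = \<Gamma>"
  by (simp add: length_measure_completion)

lemma measurable_arc_length_param [measurable]:
  "\<gamma> \<in> measurable (restrict_space lborel {0..L}) (restrict_space borel \<Gamma>)"
proof (rule measurable_restrict_space2)
  show "\<gamma> \<in> space (restrict_space lborel {0..L}) \<rightarrow> \<Gamma>"
    using arc_length_param_image by (auto simp: space_restrict_space)
  have "\<gamma> \<in> borel_measurable (restrict_space borel {0..L})"
    by (rule borel_measurable_continuous_on_restrict[OF continuous_arc_length_param])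
  then show "\<gamma> \<in> borel_measurable (restrict_space lborel {0..L})"
    by (simp cong: measurable_cong_sets sets_restrict_space_cong)
qed

lemma nn_integral_length_measure:
  assumes "h \<in> borel_measurable borel_length_measure"
  shows "(\<integral>\<^sup>+x. h x \<partial>length_measure g) = (\<integral>\<^sup>+s. h (\<gamma> s) * indicator {0..L} s \<partial>lborel)"
proof -
  have "h \<in> borel_measurable (restrict_space borel \<Gamma>)"
    using assms by (simp cong: measurable_cong_sets add: sets_borel_length_measure)
  then show ?thesis
    unfolding length_measure_completion nn_integral_completion borel_length_measure_def
    by (simp add: nn_integral_distr nn_integral_restrict_space)
qed

lemma portion_eq: "portion g t R = \<Gamma> \<inter> ball t R"
  by (auto simp: portion_def dist_norm norm_minus_commute)

lemma portion_sets_borel: "portion g t R \<in> sets borel_length_measure"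
  by (auto simp: portion_eq sets_borel_length_measure sets_restrict_space)

lemma portion_sets: "portion g t R \<in> sets (length_measure g)"
  unfolding length_measure_completion by (intro sets_completionI_sets portion_sets_borel)

text \<open>The point y forces a parameter at distance at least r from that of z. Hence an interval
  of length r adjacent to the parameter of z, on the side of y, fits into [0, L], and the
  1-Lipschitz map \<open>\<gamma>\<close> keeps it within distance r of z.\<close>

lemma emeasure_portion_ge:
  assumes z: "z \<in> \<Gamma>" and y: "y \<in> \<Gamma>" "r \<le> cmod (y - z)" and r: "0 < r"
  shows "ennreal r \<le> emeasure (length_measure g) (portion g z r)"
proof -
  obtain s t where st: "s \<in> {0..L}" "t \<in> {0..L}" "z = \<gamma> s" "y = \<gamma> t"
    using z y unfolding arc_length_param_image[symmetric] by auto
  have d: "r \<le> \<bar>t - s\<bar>" using arc_length_param_lipschitz[of t s] st y by auto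
  obtain a where a: "{a<..<a + r} \<subseteq> {0..L}" "{a<..<a + r} \<subseteq> {s - r<..<s + r}"
    using d st r by (cases "s \<le> t") (auto intro: that[of s] that[of "s - r"])
  have "ennreal r = emeasure lborel {a<..<a + r}" using r by simp
  also have "\<dots> = (\<integral>\<^sup>+x. indicator {a<..<a + r} x \<partial>lborel)" by simp
  also have "\<dots> \<le> (\<integral>\<^sup>+x. indicator (portion g z r) (\<gamma> x) * indicator {0..L} x \<partial>lborel)"
  proof (rule nn_integral_mono)
    fix x :: real
    show "indicator {a<..<a + r} x \<le> indicator (portion g z r) (\<gamma> x) * (indicator {0..L} x :: ennreal)"
    proof (cases "x \<in> {a<..<a + r}")
      case True
      then have "x \<in> {0..L}" "\<bar>x - s\<bar> < r" using a by (auto simp: subset_iff abs_less_iff)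
      moreover from this have "\<gamma> x \<in> portion g z r"
        using arc_length_param_lipschitz[of x s] st arc_length_param_image by (auto simp: portion_def)
      ultimately show ?thesis using True by (simp add: indicator_def)
    qed simp
  qed
  also have "\<dots> = emeasure (length_measure g) (portion g z r)"
    using portion_sets_borel portion_sets by (subst nn_integral_length_measure[symmetric]) auto
  finally show ?thesis .
qed

text \<open>The phase is the conjugate of the unit tangent, carried to the curve by the inverse
  \<open>u\<close> of \<open>\<gamma>\<close> on [0, L). This inverse jumps at the starting point,
  yet is Borel: its sublevel sets are empty, the whole curve, or the compact sets
  \<open>\<gamma>\<close> maps [0, a] onto.\<close>

lemma unit_phase:
  obtains \<psi> :: "complex \<Rightarrow> complex" where "\<psi> \<in> borel_measurable borel_length_measure"
    "\<And>x. cmod (\<psi> x) \<le> 1"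
    "AE s in lborel. s \<in> {0..L} \<longrightarrow> \<psi> (\<gamma> s) * vector_derivative \<gamma> (at s) = 1"
proof -
  obtain \<phi> :: "real \<Rightarrow> complex" where \<phi>: "\<phi> \<in> borel_measurable borel" "\<And>s. cmod (\<phi> s) \<le> 1"
    "AE s in lborel. s \<in> {0..L} \<longrightarrow> vector_derivative \<gamma> (at s) = \<phi> s \<and> cmod (\<phi> s) = 1"
    using arc_length_param_derivative by blast
  define u where "u = inv_into {0..<L} \<gamma>"
  have inj: "inj_on \<gamma> {0..<L}" using arc_length_param_inj by (auto simp: inj_on_def)
  have u\<gamma>: "u (\<gamma> s) = s" if "s \<in> {0..<L}" for s
    unfolding u_def by (rule inv_into_f_f[OF inj that])
  have img: "\<exists>s\<in>{0..<L}. x = \<gamma> s" if "x \<in> \<Gamma>" for x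
  proof -
    obtain s where "s \<in> {0..L}" "x = \<gamma> s" using \<open>x \<in> \<Gamma>\<close> arc_length_param_image by blast
    then show ?thesis using arc_length_param_ends L_pos
      by (cases "s = L") (auto intro!: bexI[of _ "if s = L then 0 else s"])
  qed
  have u: "u \<in> borel_measurable borel_length_measure"
  proof (rule borel_measurableI_le)
    fix a :: real
    consider "a < 0" | "0 \<le> a" "a < L" | "L \<le> a" by linarith
    then show "{x \<in> space borel_length_measure. u x \<le> a} \<in> sets borel_length_measure"
    proof cases
      case 1
      then have "{x \<in> space borel_length_measure. u x \<le> a} = {}" using img u\<gamma> by fastforce
      then show ?thesis by (simp only: sets.empty_sets)
    next
      case 2
      have "{x \<in> space borel_length_measure. u x \<le> a} = \<gamma> ` {0..a}"
      proof (intro subset_antisym subsetI)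
        fix x assume "x \<in> {x \<in> space borel_length_measure. u x \<le> a}"
        then show "x \<in> \<gamma> ` {0..a}" using img[of x] u\<gamma> by auto
      next
        fix x assume "x \<in> \<gamma> ` {0..a}"
        then show "x \<in> {x \<in> space borel_length_measure. u x \<le> a}"
          using 2 u\<gamma> arc_length_param_image by auto
      qed
      moreover have "closed (\<gamma> ` {0..a})"
        using 2 by (intro compact_imp_closed compact_continuous_image
            continuous_on_subset[OF continuous_arc_length_param]) auto
      moreover have "\<gamma> ` {0..a} \<subseteq> \<Gamma>" using 2 arc_length_param_image by auto
      ultimately show ?thesis
        by (auto simp: sets_borel_length_measure sets_restrict_space intro!: image_eqI[of _ _ "\<gamma> ` {0..a}"])
    next
      case 3
      then have "{x \<in> space borel_length_measure. u x \<le> a} = space borel_length_measure"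
        using img u\<gamma> by fastforce
      then show ?thesis by (simp only: sets.top)
    qed
  qed
  show ?thesis
  proof
    show "(\<lambda>x. cnj (\<phi> (u x))) \<in> borel_measurable borel_length_measure"
      by (intro measurable_compose[OF measurable_compose[OF u \<phi>(1)]] borel_measurable_continuous_onI)
         (intro continuous_intros)
    show "cmod (cnj (\<phi> (u x))) \<le> 1" for x using \<phi>(2) by simp
    \<comment> \<open>The parameter \<open>L\<close> is discarded: \<open>u\<close> sends the common
      value of \<open>\<gamma>\<close> at 0 and \<open>L\<close> to 0.\<close>
    show "AE s in lborel. s \<in> {0..L} \<longrightarrow> cnj (\<phi> (u (\<gamma> s))) * vector_derivative \<gamma> (at s) = 1"
      using \<phi>(3) AE_lborel_singleton[of L]
    proof eventually_elim
      case (elim s)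
      then show ?case using u\<gamma>[of s] complex_norm_square[of "\<phi> s"] by (auto simp: mult.commute)
    qed
  qed
qed

end

section \<open>Lower bounds for the Cauchy singular integral\<close>

text \<open>In the direction of a, the component of z is at least 3r - 2r = r, while r \<le> |z|
  \<le> 5r. Dividing by |z| squared, at most 25 r^2, gives the constant 1/(25 r).\<close>

lemma Re_sgn_divide_ge:
  fixes a z :: complex
  assumes a: "cmod a = 3 * r" and z: "cmod (z - a) < 2 * r"
  shows "1 / (25 * r) \<le> Re (sgn a / z)" "r \<le> cmod z"
proof -
  have r: "r > 0" using z norm_ge_zero[of "z - a"] by linarith
  have zr: "r \<le> cmod z" "cmod z \<le> 5 * r"
    using norm_triangle_ineq2[of a "a - z"] norm_triangle_ineq[of a "z - a"] a z
    by (auto simp: norm_minus_commute)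
  then show "r \<le> cmod z" by simp
  have s: "cmod (sgn a) = 1" using a r by (auto simp: norm_sgn)
  have "sgn a * cnj a = complex_of_real (3 * r)"
    using a r by (simp add: sgn_eq complex_norm_square[symmetric] power2_eq_square)
  then have e: "sgn a * cnj z = complex_of_real (3 * r) + sgn a * cnj (z - a)"
    by (simp add: algebra_simps)
  have "\<bar>Re (sgn a * cnj (z - a))\<bar> \<le> 2 * r"
    using abs_Re_le_cmod[of "sgn a * cnj (z - a)"] s z by (simp add: norm_mult del: complex_cnj_diff)
  then have "r \<le> Re (sgn a * cnj z)" unfolding e by simp
  moreover have "Re (sgn a / z) = Re (sgn a * cnj z) / (cmod z)\<^sup>2"
    by (simp add: complex_div_cnj[of "sgn a" z])
  moreover have "(cmod z)\<^sup>2 \<le> (5 * r)\<^sup>2" using zr by (intro power_mono) auto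
  moreover have "0 < (cmod z)\<^sup>2" using zr r by auto
  ultimately have "r / (5 * r)\<^sup>2 \<le> Re (sgn a / z)"
    using r by (auto intro!: frac_le)
  then show "1 / (25 * r) \<le> Re (sgn a / z)" using r by (simp add: power2_eq_square)
qed

context rectifiable_jordan
begin

text \<open>At distance r from the support of f the truncation no longer matters: for 0 < R \<le> r
  the omitted part of the curve carries no values of f, so the truncated integrals are constant in
  R.\<close>

lemma cauchy_singular_integral_off_support:
  assumes supp: "\<And>\<tau>. \<tau> \<in> \<Gamma> \<Longrightarrow> f \<tau> \<noteq> 0 \<Longrightarrow> r \<le> cmod (\<tau> - x)" and r: "0 < r"
  shows "cauchy_singular_integral g f x = cauchy_truncated g f x r"
proof -
  have eq: "cauchy_truncated g f x R = cauchy_truncated g f x r" if R: "0 < R" "R \<le> r" for R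
  proof -
    have pt: "indicator (param_set g (\<Gamma> - portion g x R)) s *\<^sub>R line_integrand g (\<lambda>\<tau>. f \<tau> / (\<tau> - x)) s
        = indicator (param_set g (\<Gamma> - portion g x r)) s *\<^sub>R line_integrand g (\<lambda>\<tau>. f \<tau> / (\<tau> - x)) s" for s
    proof (cases "s \<in> {0..L} \<and> f (\<gamma> s) \<noteq> 0")
      case True
      then have "\<gamma> s \<in> \<Gamma>" using arc_length_param_image by auto
      then show ?thesis using True supp[of "\<gamma> s"] R
        by (auto simp: param_set_def portion_def indicator_def)
    next
      case False
      then show ?thesis by (auto simp: param_set_def line_integrand_def)
    qed
    have "integral\<^sup>L lebesgue (\<lambda>s. indicator (param_set g (\<Gamma> - portion g x R)) s *\<^sub>R line_integrand g (\<lambda>\<tau>. f \<tau> / (\<tau> - x)) s)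
        = integral\<^sup>L lebesgue (\<lambda>s. indicator (param_set g (\<Gamma> - portion g x r)) s *\<^sub>R line_integrand g (\<lambda>\<tau>. f \<tau> / (\<tau> - x)) s)"
      by (rule Bochner_Integration.integral_cong[OF refl pt])
    then show ?thesis
      unfolding cauchy_truncated_def line_integral_def set_lebesgue_integral_def
      by (rule arg_cong[where f="\<lambda>z. 1 / (of_real pi * \<i>) * z"])
  qed
  have "\<forall>\<^sub>F R in at_right 0. cauchy_truncated g f x R = cauchy_truncated g f x r"
    by (rule eventually_at_rightI[of 0 r]) (use r in \<open>auto intro: eq\<close>)
  then have "(cauchy_truncated g f x \<longlongrightarrow> cauchy_truncated g f x r) (at_right 0)"
    by (rule tendsto_eventually)
  then show ?thesis unfolding cauchy_singular_integral_def
    by (intro tendsto_Lim) (simp_all add: trivial_limit_at_right_real)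
qed

text \<open>The phase \<open>\<psi>\<close> cancels the direction of the tangent, so the Cauchy integral of \<open>q \<psi>\<close> over a
  set that is seen from \<open>x\<close> under a small angle controls the length integral of \<open>q\<close>.\<close>

lemma nn_integral_le_cauchy_singular_integral:
  fixes q :: "complex \<Rightarrow> real"
  assumes q: "q \<in> borel_measurable borel_length_measure" "\<And>\<tau>. 0 \<le> q \<tau>"
    and \<psi>: "AE s in lborel. s \<in> {0..L} \<longrightarrow> \<psi> (\<gamma> s) * vector_derivative \<gamma> (at s) = 1"
    and supp: "\<And>\<tau>. \<tau> \<in> \<Gamma> \<Longrightarrow> q \<tau> \<noteq> 0 \<Longrightarrow> cmod ((\<tau> - x) - a) < 2 * r"
    and a: "cmod a = 3 * r" and r: "0 < r"
    and ex: "cauchy_singular_integral_exists g (\<lambda>\<tau>. of_real (q \<tau>) * \<psi> \<tau>) x"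
  shows "(\<integral>\<^sup>+\<tau>. ennreal (q \<tau>) \<partial>length_measure g)
    \<le> ennreal (25 * pi * r) * ennreal (cmod (cauchy_singular_integral g (\<lambda>\<tau>. of_real (q \<tau>) * \<psi> \<tau>) x))"
proof -
  define f where "f \<tau> = complex_of_real (q \<tau>) * \<psi> \<tau>" for \<tau>
  define Q where "Q s = indicator (param_set g (\<Gamma> - portion g x r)) s *\<^sub>R line_integrand g (\<lambda>\<tau>. f \<tau> / (\<tau> - x)) s" for s
  have geo: "1 / (25 * r) \<le> Re (sgn a / (\<tau> - x))" "r \<le> cmod (\<tau> - x)" if "\<tau> \<in> \<Gamma>" "q \<tau> \<noteq> 0" for \<tau>
    using Re_sgn_divide_ge[OF a supp[OF that]] by auto
  \<comment> \<open>Integrability is part of the existence of S f at x; no integrability of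
    \<open>q\<close> has to be assumed.\<close>
  have Qint: "integrable lebesgue Q"
    using ex r unfolding cauchy_singular_integral_exists_def line_integrable_def set_integrable_def Q_def f_def
    by auto
  have "cauchy_singular_integral g f x = cauchy_truncated g f x r"
    by (rule cauchy_singular_integral_off_support) (use geo r in \<open>auto simp: f_def\<close>)
  also have "\<dots> = 1 / (of_real pi * \<i>) * integral\<^sup>L lebesgue Q"
    by (simp only: cauchy_truncated_def line_integral_def set_lebesgue_integral_def Q_def[abs_def])
  finally have S: "cmod (integral\<^sup>L lebesgue Q) = pi * cmod (cauchy_singular_integral g f x)"
    by (simp add: norm_mult norm_divide)
  \<comment> \<open>After cancellation of the tangent the integrand is q/(tau - x). Its component in
    the fixed direction \<open>sgn a\<close> is at least q/(25 r), so nothing cancels in the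
    integral.\<close>
  have lower: "AE s in lborel. ennreal (q (\<gamma> s)) * indicator {0..L} s \<le> ennreal (25 * r * Re (sgn a * Q s))
      \<and> 0 \<le> Re (sgn a * Q s)"
    using \<psi>
  proof eventually_elim
    case (elim s)
    show ?case
    proof (cases "s \<in> {0..L} \<and> q (\<gamma> s) \<noteq> 0")
      case True
      then have \<gamma>s: "\<gamma> s \<in> \<Gamma>" using arc_length_param_image by auto
      have "Q s = q (\<gamma> s) * (\<psi> (\<gamma> s) * vector_derivative \<gamma> (at s)) / (\<gamma> s - x)"
        using True \<gamma>s geo(2)[of "\<gamma> s"]
        by (simp add: Q_def line_integrand_def f_def param_set_def portion_def)
      also have "\<dots> = q (\<gamma> s) / (\<gamma> s - x)" using elim True by simp
      finally have "sgn a * Q s = of_real (q (\<gamma> s)) * (sgn a / (\<gamma> s - x))" by simp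
      then have re: "Re (sgn a * Q s) = q (\<gamma> s) * Re (sgn a / (\<gamma> s - x))" by (simp only: Re_complex_of_real times_complex.sel Im_complex_of_real mult_zero_left diff_zero)
      have "q (\<gamma> s) * (1 / (25 * r)) \<le> Re (sgn a * Q s)"
        unfolding re using geo(1)[OF \<gamma>s] True q(2) by (intro mult_left_mono) auto
      then have "q (\<gamma> s) \<le> 25 * r * Re (sgn a * Q s)"
        using r by (simp add: field_simps)
      moreover have "0 \<le> Re (sgn a * Q s)"
      proof -
        have "0 \<le> 1 / (25 * r)" using r by simp
        also have "\<dots> \<le> Re (sgn a / (\<gamma> s - x))" using geo(1)[OF \<gamma>s] True by simp
        finally show ?thesis unfolding re using q(2) by (intro mult_nonneg_nonneg)
      qed
      ultimately show ?thesis using True by (auto intro: ennreal_leI)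
    next
      case False
      then have "Q s = 0" by (auto simp: Q_def line_integrand_def f_def param_set_def)
      then show ?thesis using False by (auto simp: indicator_def)
    qed
  qed
  have "(\<integral>\<^sup>+\<tau>. ennreal (q \<tau>) \<partial>length_measure g) = (\<integral>\<^sup>+s. ennreal (q (\<gamma> s)) * indicator {0..L} s \<partial>lborel)"
    by (rule nn_integral_length_measure) (use q in measurable)
  also have "\<dots> = (\<integral>\<^sup>+s. ennreal (q (\<gamma> s)) * indicator {0..L} s \<partial>lebesgue)"
    by (simp add: nn_integral_completion)
  also have "\<dots> \<le> (\<integral>\<^sup>+s. ennreal (25 * r * Re (sgn a * Q s)) \<partial>lebesgue)"
    by (rule nn_integral_mono_AE, rule AE_completion, use lower in eventually_elim) simp
  also have "\<dots> = ennreal (\<integral>s. 25 * r * Re (sgn a * Q s) \<partial>lebesgue)"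
  proof (rule nn_integral_eq_integral)
    show "integrable lebesgue (\<lambda>s. 25 * r * Re (sgn a * Q s))"
      using Qint by (intro integrable_mult_right integrable_Re)
    show "AE s in lebesgue. 0 \<le> 25 * r * Re (sgn a * Q s)"
      by (rule AE_completion, use lower in eventually_elim) (use r in simp)
  qed
  also have "(\<integral>s. 25 * r * Re (sgn a * Q s) \<partial>lebesgue) = 25 * r * Re (sgn a * integral\<^sup>L lebesgue Q)"
  proof -
    have "(\<integral>s. 25 * r * Re (sgn a * Q s) \<partial>lebesgue) = 25 * r * (\<integral>s. Re (sgn a * Q s) \<partial>lebesgue)"
      by (rule integral_mult_right_zero)
    also have "(\<integral>s. Re (sgn a * Q s) \<partial>lebesgue) = Re (\<integral>s. sgn a * Q s \<partial>lebesgue)"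
      using Qint by (intro integral_Re integrable_mult_right)
    finally show ?thesis by simp
  qed
  also have "\<dots> \<le> 25 * r * (pi * cmod (cauchy_singular_integral g f x))"
  proof -
    have "cmod (sgn a) = 1" using a r by (auto simp: norm_sgn)
    then have "Re (sgn a * integral\<^sup>L lebesgue Q) \<le> pi * cmod (cauchy_singular_integral g f x)"
      unfolding S[symmetric] using complex_Re_le_cmod[of "sgn a * integral\<^sup>L lebesgue Q"] by (simp add: norm_mult)
    then show ?thesis using r by (intro mult_left_mono) auto
  qed
  finally show ?thesis using r
    by (simp add: f_def[abs_def] ennreal_mult[symmetric] ennreal_leI mult.assoc mult.left_commute)
qed

text \<open>For h of norm at most 1, the function f = psi h/w on \<open>B\<close> has norm at most 1
  in X_w, and on \<open>D\<close> the modulus of S f is at least the integral of h/w over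
  \<open>B\<close> divided by 25 pi r. Taking the norm of w S f and then the supremum over h
  produces the associate norm.\<close>

lemma weighted_norms_separated:
  assumes w: "weight (length_measure g) w"
    and bfn: "banach_function_norm (length_measure g) \<rho>"
    and C: "\<And>f. f \<in> weighted_space (length_measure g) \<rho> w \<Longrightarrow>
        (AE t in length_measure g. cauchy_singular_integral_exists g f t) \<and>
        cauchy_singular_integral g f \<in> weighted_space (length_measure g) \<rho> w \<and>
        weighted_norm \<rho> w (cauchy_singular_integral g f) \<le> ennreal C * weighted_norm \<rho> w f"
    and B: "B \<in> sets borel_length_measure" and D: "D \<in> sets (length_measure g)"
    and BD: "\<And>\<tau> x. \<tau> \<in> B \<Longrightarrow> x \<in> D \<Longrightarrow> cmod ((\<tau> - x) - a) < 2 * r"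
    and a: "cmod a = 3 * r" and r: "0 < r"
  shows "\<rho> (\<lambda>x. w x * indicator D x) * associate_norm (length_measure g) \<rho> (\<lambda>x. indicator B x / w x)
    \<le> ennreal (25 * pi * r) * ennreal C"
proof -
  let ?M = "length_measure g"
  note bm = bfn_mono[OF bfn] and bc = bfn_cmult[OF bfn] and b0 = bfn_eq_0_iff[OF bfn]
  have [measurable]: "w \<in> borel_measurable ?M" and wae: "AE x in ?M. 0 < w x \<and> w x < \<infinity>"
    using w by (auto simp: weight_def)
  have [measurable]: "D \<in> sets ?M" by fact
  note [measurable] = B
  have compl: "h \<in> borel_measurable ?M" if "h \<in> borel_measurable borel_length_measure" for h :: "complex \<Rightarrow> 'b::topological_space"
    unfolding length_measure_completion by (rule measurable_completion[OF that])
  obtain \<psi> where \<psi> [measurable]: "\<psi> \<in> borel_measurable borel_length_measure" and \<psi>1: "\<And>x. cmod (\<psi> x) \<le> 1"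
    and \<psi>ae: "AE s in lborel. s \<in> {0..L} \<longrightarrow> \<psi> (\<gamma> s) * vector_derivative \<gamma> (at s) = 1"
    using unit_phase by blast
  \<comment> \<open>Borel versions of w and h make the density \<open>q\<close> Borel, as the
    pullback to the parameter interval demands.\<close>
  obtain w' where [measurable]: "w' \<in> borel_measurable borel_length_measure" and "AE x in borel_length_measure. w x = w' x"
    using completion_ex_borel_measurable \<open>w \<in> borel_measurable ?M\<close> unfolding length_measure_completion by blast
  then have w': "AE x in ?M. w x = w' x" unfolding length_measure_completion by (intro AE_completion)
  have main: "\<rho> (\<lambda>x. w x * indicator D x) * (\<integral>\<^sup>+x. h x * (indicator B x / w x) \<partial>?M) \<le> ennreal (25 * pi * r) * ennreal C"
    if h: "h \<in> borel_measurable ?M" "\<rho> h \<le> 1" for h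
  proof -
    note [measurable] = h(1)
    obtain h' where [measurable]: "h' \<in> borel_measurable borel_length_measure" and "AE x in borel_length_measure. h x = h' x"
      using completion_ex_borel_measurable h(1) unfolding length_measure_completion by blast
    then have h': "AE x in ?M. h x = h' x" unfolding length_measure_completion by (intro AE_completion)
    have hfin: "AE x in ?M. h x < \<infinity>"
      using h(2) by (intro bfn_AE_finite[OF bfn h(1)]) (auto simp: less_top[symmetric] top_unique)
    define q where "q x = enn2real (h' x / w' x) * indicator B x" for x
    have q [measurable]: "q \<in> borel_measurable borel_length_measure" unfolding q_def by measurable
    have q0: "0 \<le> q x" for x by (simp add: q_def)
    have qae: "AE x in ?M. ennreal (q x) = h x * (indicator B x / w x) \<and> ennreal (q x) * w x \<le> h x"
      using w' h' hfin wae
    proof eventually_elim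
      case (elim x)
      have fin: "h x < \<infinity>" "w x < \<infinity>" "0 < w x" using elim by auto
      obtain k where k: "h x = ennreal k" "0 \<le> k"
        using fin(1) by (cases "h x") auto
      obtain l where l: "w x = ennreal l" "0 < l"
        using fin(2,3) by (cases "w x") (auto simp: ennreal_less_zero_iff)
      note kl = k l
      then have "q x = k / l * indicator B x"
        using elim by (simp add: q_def divide_ennreal)
      then show ?case using kl by (auto simp: indicator_def divide_ennreal ennreal_times_divide ennreal_mult[symmetric])
    qed
    define f where "f \<tau> = complex_of_real (q \<tau>) * \<psi> \<tau>" for \<tau>
    have [measurable]: "f \<in> borel_measurable ?M" unfolding f_def by (rule compl) measurable
    have fq: "cmod (f x) \<le> q x" for x
      using mult_left_mono[OF \<psi>1[of x] q0[of x]] q0[of x] by (simp add: f_def norm_mult)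
    have fn: "weighted_norm \<rho> w f \<le> 1"
    proof -
      have "weighted_norm \<rho> w f \<le> \<rho> h"
        unfolding weighted_norm_def
      proof (rule bm)
        show "AE x in ?M. ennreal (cmod (f x)) * w x \<le> h x"
          using qae
        proof eventually_elim
          case (elim x)
          have "ennreal (cmod (f x)) * w x \<le> ennreal (q x) * w x"
            using fq by (intro mult_right_mono ennreal_leI) auto
          also have "\<dots> \<le> h x" using elim by blast
          finally show ?case .
        qed
      qed measurable
      then show ?thesis using h(2) by simp
    qed
    then have fX: "f \<in> weighted_space ?M \<rho> w"
      by (auto simp: weighted_space_def intro: le_less_trans)
    let ?S = "cauchy_singular_integral g f"
    have [measurable]: "?S \<in> borel_measurable ?M" using C[OF fX] by (simp add: weighted_space_def)
    have "weighted_norm \<rho> w ?S \<le> ennreal C * weighted_norm \<rho> w f" using C[OF fX] by blast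
    also have "\<dots> \<le> ennreal C * 1" using fn by (rule mult_left_mono) simp
    finally have Sn: "weighted_norm \<rho> w ?S \<le> ennreal C" by simp
    define I where "I = (\<integral>\<^sup>+x. ennreal (q x) \<partial>?M)"
    have I: "I = (\<integral>\<^sup>+x. h x * (indicator B x / w x) \<partial>?M)"
      unfolding I_def by (rule nn_integral_cong_AE, use qae in eventually_elim) simp
    have "AE x in ?M. cauchy_singular_integral_exists g f x" using C[OF fX] by blast
    then have IS: "AE x in ?M. x \<in> D \<longrightarrow> I \<le> ennreal (25 * pi * r) * ennreal (cmod (?S x))"
    proof eventually_elim
      case (elim x)
      show ?case
      proof
        assume x: "x \<in> D"
        show "I \<le> ennreal (25 * pi * r) * ennreal (cmod (?S x))"
          unfolding I_def f_def[abs_def]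
        proof (rule nn_integral_le_cauchy_singular_integral[OF q q0 \<psi>ae _ a r])
          show "cmod ((\<tau> - x) - a) < 2 * r" if "q \<tau> \<noteq> 0" for \<tau>
            using that BD[OF _ x] by (auto simp: q_def indicator_def split: if_splits)
          show "cauchy_singular_integral_exists g (\<lambda>\<tau>. complex_of_real (q \<tau>) * \<psi> \<tau>) x"
            using elim by (simp add: f_def[abs_def])
        qed
      qed
    qed
    have "\<rho> (\<lambda>x. w x * indicator D x) * I \<le> ennreal (25 * pi * r) * ennreal C"
    \<comment> \<open>Since S f takes finite values, an infinite \<open>I\<close> is compatible with
      the pointwise bound only if \<open>D\<close> is null. Then the left factor is 0 and so is the
      product.\<close>
    proof (cases "I = \<infinity>")
      case True
      have "AE x in ?M. w x * indicator D x = 0"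
        using IS by eventually_elim (auto simp: True indicator_def top_unique ennreal_mult_eq_top_iff)
      then have "\<rho> (\<lambda>x. w x * indicator D x) = 0" by (subst b0) auto
      then show ?thesis by simp
    next
      case False
      then obtain i where i: "I = ennreal i" "0 \<le> i" by (cases I) auto
      have "I * \<rho> (\<lambda>x. w x * indicator D x) = \<rho> (\<lambda>x. I * (w x * indicator D x))"
        unfolding i(1) by (rule bc[symmetric]) (use i in auto)
      also have "\<dots> \<le> \<rho> (\<lambda>x. ennreal (25 * pi * r) * (ennreal (cmod (?S x)) * w x))"
      proof (rule bm)
        show "AE x in ?M. I * (w x * indicator D x) \<le> ennreal (25 * pi * r) * (ennreal (cmod (?S x)) * w x)"
          using IS
        proof eventually_elim
          case (elim x)
          show ?case
          proof (cases "x \<in> D")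
            case True
            then have "I * w x \<le> ennreal (25 * pi * r) * ennreal (cmod (?S x)) * w x"
              using elim by (intro mult_right_mono) auto
            then show ?thesis using True by (simp add: mult.assoc)
          qed simp
        qed
      qed measurable
      also have "\<dots> = ennreal (25 * pi * r) * weighted_norm \<rho> w ?S"
        unfolding weighted_norm_def by (rule bc) (use r in auto)
      also have "\<dots> \<le> ennreal (25 * pi * r) * ennreal C" using Sn by (rule mult_left_mono) simp
      finally show ?thesis by (simp add: mult.commute)
    qed
    then show ?thesis by (simp add: I)
  qed
  show ?thesis
    unfolding associate_norm_def
    by (subst SUP_mult_left_ennreal) (auto intro!: SUP_least main)
qed

lemma portion_weighted_norms:
  assumes w: "weight (length_measure g) w"
    and bfn: "banach_function_norm (length_measure g) \<rho>"
    and C: "\<And>f. f \<in> weighted_space (length_measure g) \<rho> w \<Longrightarrow>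
        (AE t in length_measure g. cauchy_singular_integral_exists g f t) \<and>
        cauchy_singular_integral g f \<in> weighted_space (length_measure g) \<rho> w \<and>
        weighted_norm \<rho> w (cauchy_singular_integral g f) \<le> ennreal C * weighted_norm \<rho> w f"
    and C0: "0 \<le> C"
    and t: "t \<in> \<Gamma>" and y: "y \<in> \<Gamma>" "3 * r \<le> cmod (y - t)" and r: "0 < r"
  shows "ennreal (1 / r) * \<rho> (\<lambda>x. w x * indicator (portion g t r) x)
      * associate_norm (length_measure g) \<rho> (\<lambda>x. indicator (portion g t r) x / w x) \<le> ennreal ((25 * pi * C)\<^sup>2)"
    and "\<rho> (\<lambda>x. w x * indicator (portion g t r) x) < \<infinity>"
    and "associate_norm (length_measure g) \<rho> (\<lambda>x. indicator (portion g t r) x / w x) < \<infinity>"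
proof -
  have "connected ((\<lambda>z. cmod (z - t)) ` \<Gamma>)"
    using continuous_g by (intro connected_continuous_image connected_path_image continuous_intros)
      (simp add: path_def)
  then have "{cmod (t - t)..cmod (y - t)} \<subseteq> (\<lambda>z. cmod (z - t)) ` \<Gamma>"
    using t y by (intro connected_contains_Icc imageI)
  moreover have "3 * r \<in> {cmod (t - t)..cmod (y - t)}" using y r by simp
  ultimately obtain z where z: "z \<in> \<Gamma>" "cmod (z - t) = 3 * r" by fastforce
  define a a' b b' where
    "a = \<rho> (\<lambda>x. w x * indicator (portion g t r) x)" and
    "a' = associate_norm (length_measure g) \<rho> (\<lambda>x. indicator (portion g t r) x / w x)" and
    "b = \<rho> (\<lambda>x. w x * indicator (portion g z r) x)" and
    "b' = associate_norm (length_measure g) \<rho> (\<lambda>x. indicator (portion g z r) x / w x)"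
  define K where "K = 25 * pi * C"
  have K: "0 \<le> K" using C0 by (simp add: K_def)
  \<comment> \<open>Stated for arbitrary centres, so that it serves both orders: a = t - z for
    \<open>ba\<close> and a = z - t for \<open>ab\<close>.\<close>
  have sep: "cmod ((\<tau> - x) - (p - q)) < 2 * r" if "\<tau> \<in> portion g p r" "x \<in> portion g q r" for \<tau> x p q
  proof -
    have "cmod ((\<tau> - x) - (p - q)) = cmod ((\<tau> - p) - (x - q))"
      by (rule arg_cong[where f=cmod]) (simp add: algebra_simps)
    also have "\<dots> \<le> cmod (\<tau> - p) + cmod (x - q)" by (rule norm_triangle_ineq4)
    also have "\<dots> < 2 * r" using that by (simp add: portion_def)
    finally show ?thesis .
  qed
  have e: "ennreal (25 * pi * r) * ennreal C = ennreal (K * r)"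
    using r C0 by (simp add: K_def ennreal_mult[symmetric] mult_ac)
  have ba: "b * a' \<le> ennreal (K * r)"
    unfolding a'_def b_def e[symmetric]
    by (rule weighted_norms_separated[OF w bfn C portion_sets_borel portion_sets sep _ r])
       (use z in \<open>auto simp: norm_minus_commute\<close>)
  have ab: "a * b' \<le> ennreal (K * r)"
    unfolding b'_def a_def e[symmetric]
    by (rule weighted_norms_separated[OF w bfn C portion_sets_borel portion_sets sep _ r])
       (use z in auto)
  have "ennreal r \<le> emeasure (length_measure g) (portion g z r)"
    using z t r by (intro emeasure_portion_ge[of z t]) (auto simp: norm_minus_commute)
  also have "\<dots> \<le> b * b'"
    unfolding b_def b'_def by (rule emeasure_le_weighted_norms[OF bfn w portion_sets])
  finally have bb: "ennreal r \<le> b * b'" .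
  \<comment> \<open>Nonvanishing of \<open>b\<close> and \<open>b'\<close> turns the finite bounds
    on \<open>b * a'\<close> and \<open>a * b'\<close> into finiteness of \<open>a'\<close> and
    \<open>a\<close>.\<close>
  then have "b \<noteq> 0" "b' \<noteq> 0" using r by (auto simp: ennreal_eq_0_iff)
  have fin: "u < \<infinity>" if "v * u \<le> ennreal x" "v \<noteq> 0" for u v :: ennreal and x
    using that ennreal_less_top[of x] by (metis ennreal_mult_eq_top_iff infinity_ennreal_def leD top.not_eq_extremum)
  show "\<rho> (\<lambda>x. w x * indicator (portion g t r) x) < \<infinity>"
    using fin[of b' a] ab \<open>b' \<noteq> 0\<close> by (simp add: a_def mult.commute)
  show "associate_norm (length_measure g) \<rho> (\<lambda>x. indicator (portion g t r) x / w x) < \<infinity>"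
    using fin[of b a'] ba \<open>b \<noteq> 0\<close> by (simp add: a'_def)
  \<comment> \<open>Regrouping the four factors bounds r a a' by (K r)^2. Only the real number r^2
    is divided out, never a norm.\<close>
  have "ennreal r * (a * a') \<le> (b * b') * (a * a')"
    using bb by (rule mult_right_mono) simp
  also have "\<dots> = (b * a') * (a * b')" by (simp add: mult_ac)
  also have "\<dots> \<le> ennreal (K * r) * ennreal (K * r)" using ba ab by (rule mult_mono) auto
  finally have "ennreal (1 / r\<^sup>2) * (ennreal r * (a * a')) \<le> ennreal (1 / r\<^sup>2) * (ennreal (K * r) * ennreal (K * r))"
    by (rule mult_left_mono) simp
  also have "ennreal (1 / r\<^sup>2) * (ennreal r * (a * a')) = ennreal (1 / r) * a * a'"
    using r by (simp add: mult.assoc[symmetric] ennreal_mult[symmetric] power2_eq_square)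
  also have "ennreal (1 / r\<^sup>2) * (ennreal (K * r) * ennreal (K * r)) = ennreal (K\<^sup>2)"
    using r K by (simp add: ennreal_mult[symmetric] power2_eq_square)
  finally show "ennreal (1 / r) * \<rho> (\<lambda>x. w x * indicator (portion g t r) x)
      * associate_norm (length_measure g) \<rho> (\<lambda>x. indicator (portion g t r) x / w x) \<le> ennreal ((25 * pi * C)\<^sup>2)"
    by (simp add: a_def a'_def K_def)
qed

end

section \<open>From small radii to all radii\<close>

theorem theorem6p1:
  fixes g :: "real \<Rightarrow> complex"
    and w :: "complex \<Rightarrow> ennreal"
    and \<rho> :: "(complex \<Rightarrow> ennreal) \<Rightarrow> ennreal"
  assumes "rectifiable_jordan_curve g"
    and "counterclockwise g"
    and "weight (length_measure g) w"
    and "banach_function_norm (length_measure g) \<rho>"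
    and "cauchy_singular_bounded g \<rho> w"
  shows "w \<in> A_class g \<rho>"
proof -
  interpret rectifiable_jordan g by unfold_locales fact
  let ?M = "length_measure g"
  note w = assms(3) and bfn = assms(4)
  have [measurable]: "w \<in> borel_measurable ?M" using w by (simp add: weight_def)
  note [measurable] = portion_sets
  obtain C0 :: real where "\<forall>f \<in> weighted_space ?M \<rho> w.
        (AE t in ?M. cauchy_singular_integral_exists g f t) \<and>
        cauchy_singular_integral g f \<in> weighted_space ?M \<rho> w \<and>
        weighted_norm \<rho> w (cauchy_singular_integral g f) \<le> ennreal C0 * weighted_norm \<rho> w f"
    using assms(5) unfolding cauchy_singular_bounded_def by blast
  \<comment> \<open>\<open>ennreal\<close> identifies negative constants with 0, so the bound may be
    taken nonnegative.\<close>
  moreover define C where "C = max 0 C0"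
  moreover have "ennreal C0 = ennreal C" by (simp add: C_def max_def ennreal_neg)
  ultimately have C: "0 \<le> C" "\<And>f. f \<in> weighted_space ?M \<rho> w \<Longrightarrow>
        (AE t in ?M. cauchy_singular_integral_exists g f t) \<and>
        cauchy_singular_integral g f \<in> weighted_space ?M \<rho> w \<and>
        weighted_norm \<rho> w (cauchy_singular_integral g f) \<le> ennreal C * weighted_norm \<rho> w f"
    by auto
  have "g 0 \<noteq> g (1/2)" using loop_free_g[of 0 "1/2"] by auto
  \<comment> \<open>Two fixed points of the curve are 6 \<open>R0\<close> apart, so every t is at
    distance at least 3 \<open>R0\<close> from one of them. The threshold for small radii is thus
    uniform in t.\<close>
  define R0 where "R0 = cmod (g 0 - g (1/2)) / 6"
  have R0: "0 < R0" using \<open>g 0 \<noteq> g (1/2)\<close> by (simp add: R0_def)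
  have far: "\<exists>y\<in>\<Gamma>. 3 * r \<le> cmod (y - t)" if "r \<le> R0" for t r
  proof -
    have "6 * R0 \<le> cmod (g 0 - t) + cmod (g (1/2) - t)"
      using norm_triangle_ineq4[of "g 0 - t" "g (1/2) - t"] by (simp add: R0_def)
    then have "3 * r \<le> cmod (g 0 - t) \<or> 3 * r \<le> cmod (g (1/2) - t)" using that by linarith
    then show ?thesis by (auto simp: path_image_def)
  qed
  define \<Phi> where "\<Phi> t r = \<rho> (\<lambda>\<tau>. w \<tau> * indicator (portion g t r) \<tau>)" for t r
  define \<Phi>' where "\<Phi>' t r = associate_norm ?M \<rho> (\<lambda>\<tau>. indicator (portion g t r) \<tau> / w \<tau>)" for t r
  have small: "ennreal (1 / r) * \<Phi> t r * \<Phi>' t r \<le> ennreal ((25 * pi * C)\<^sup>2)" "\<Phi> t r < \<infinity>" "\<Phi>' t r < \<infinity>"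
    if "t \<in> \<Gamma>" "0 < r" "r \<le> R0" for t r
    using far[OF that(3), of t] portion_weighted_norms[OF w bfn C(2) C(1) that(1) _ _ that(2)]
    by (auto simp: \<Phi>_def \<Phi>'_def)
  have "compact \<Gamma>" using continuous_g by (intro compact_path_image) (simp add: path_def)
  then obtain T where T: "finite T" "T \<subseteq> \<Gamma>" "\<Gamma> \<subseteq> (\<Union>t\<in>T. ball t R0)"
    by (rule compactE_image[of \<Gamma> \<Gamma> "\<lambda>t. ball t R0"]) (use R0 in auto)
  have cover: "\<exists>s\<in>T. \<tau> \<in> portion g s R0" if "\<tau> \<in> \<Gamma>" for \<tau>
    using subsetD[OF T(3) that] that by (auto simp: portion_eq)
  define S S' where "S = (\<Sum>s\<in>T. \<Phi> s R0)" and "S' = (\<Sum>s\<in>T. \<Phi>' s R0)"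
  \<comment> \<open>The finitely many portions of radius \<open>R0\<close> cover the curve, so these
    sums bound both norms for every radius. For r > \<open>R0\<close> the factor 1/r is at most
    1/\<open>R0\<close>.\<close>
  have large: "\<Phi> t r \<le> S" "\<Phi>' t r \<le> S'" for t r
  proof -
    have le: "h \<tau> * indicator (portion g t r) \<tau> \<le> (\<Sum>s\<in>T. h \<tau> * indicator (portion g s R0) \<tau>)"
      if \<tau>: "\<tau> \<in> \<Gamma>" for \<tau> and h :: "complex \<Rightarrow> ennreal"
    proof -
      obtain s where s: "s \<in> T" "\<tau> \<in> portion g s R0" using cover[OF \<tau>] by blast
      have "h \<tau> * indicator (portion g t r) \<tau> \<le> h \<tau> * indicator (portion g s R0) \<tau>"
        using s by (auto simp: indicator_def)
      also have "\<dots> \<le> (\<Sum>s\<in>T. h \<tau> * indicator (portion g s R0) \<tau>)"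
        using T(1) s(1) by (intro member_le_sum) auto
      finally show ?thesis .
    qed
    have "\<Phi> t r \<le> \<rho> (\<lambda>\<tau>. \<Sum>s\<in>T. w \<tau> * indicator (portion g s R0) \<tau>)"
      unfolding \<Phi>_def by (rule bfn_mono[OF bfn]) (auto intro!: AE_I2 le)
    also have "\<dots> \<le> S"
      unfolding S_def \<Phi>_def using T(1) by (intro bfn_sum[OF bfn]) auto
    finally show "\<Phi> t r \<le> S" .
    show "\<Phi>' t r \<le> S'"
      unfolding S'_def \<Phi>'_def using T(1)
    proof (rule associate_norm_sum[OF bfn])
      fix \<tau> assume "\<tau> \<in> space ?M"
      then show "indicator (portion g t r) \<tau> / w \<tau> \<le> (\<Sum>s\<in>T. indicator (portion g s R0) \<tau> / w \<tau>)"
        using le[of \<tau> "\<lambda>\<tau>. 1 / w \<tau>"] by (simp add: divide_ennreal_def mult.commute)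
    qed measurable
  qed
  define B where "B = ennreal ((25 * pi * C)\<^sup>2) + ennreal (1 / R0) * S * S'"
  have "S < \<infinity>" "S' < \<infinity>"
    unfolding S_def S'_def using T small(2,3)[OF _ R0 order_refl] by (auto simp: ennreal_sum_less_top subset_iff)
  then have B: "B < \<infinity>" by (simp add: B_def ennreal_mult_less_top)
  have bound: "ennreal (1 / r) * \<Phi> t r * \<Phi>' t r \<le> B" if "t \<in> \<Gamma>" "0 < r" for t r
  proof (cases "r \<le> R0")
    case True
    then show ?thesis using small(1)[OF that True] by (auto simp: B_def intro: order_trans add_increasing2)
  next
    case False
    have "ennreal (1 / r) * \<Phi> t r * \<Phi>' t r \<le> ennreal (1 / R0) * S * S'"
      using large[of t r] False R0 by (intro mult_mono ennreal_leI) (auto intro: frac_le)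
    then show ?thesis by (auto simp: B_def intro: add_increasing)
  qed
  have "(SUP t \<in> \<Gamma>. SUP r \<in> {0<..}. ennreal (1 / r) * \<Phi> t r * \<Phi>' t r) \<le> B"
    using bound by (intro SUP_least) auto
  then show ?thesis
    using w B unfolding A_class_def \<Phi>_def \<Phi>'_def by (auto intro: le_less_trans)
qed

end
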